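(* Let $q\in[0,1)$ and $\alpha,\beta>0$ be fixed, and write $u(\alpha)=\frac{1-q}{\alpha}-1$, $v(\beta)=\frac{1-q}{\beta}-1$, $u=u(\alpha)$, $v=v(\beta)$. (i) Assume $uv>1$ and $u>\max(1,v)$ (low density phase in the shock region). Assume there exist $\beta',\beta''>0$ with $\beta\in[\beta',\beta'']$ and some constant $k\in\mathbb{N}=\{1,2,\dots\}$ such that $v'=v(\beta')$ and $v''=v(\beta'')$ satisfy $$u>\max(v',v'',1)\quad\text{and}\quad uv'q^{k}=uv''q^{k-1}=1 .$$ Then for all intervals $I=\{a,\dots,b\}\subseteq\{1,\dots,N\}$ (with $a=a(N)$, $b=b(N)$) such that $N-b\gg1$, $$\lim_{N\to\infty}\left\|\mu_I-\mathrm{Ber}_I\left(\tfrac{\alpha}{1-q}\right)\right\|_{\mathrm{TV}}=0 .$$ (ii) Assume $uv>1$ and $v>\max(1,u)$ (high density phase in the shock region). Assume there exist $\alpha',\alpha''>0$ with $\alpha\in[\alpha',\alpha'']$ and some constant $k\in\mathbb{N}$ such that $u'=u(\alpha')$ and $u''=u(\alpha'')$ satisfy $v>\max(u',u'',1)$ and $u'vq^{k}=u''vq^{k-1}=1$. Then for all intervals $I=\{a,\dots,b\}\subseteq\{1,\dots,N\}$ such that $a\gg1$, $$\lim_{N\to\infty}\left\|\mu_I-\mathrm{Ber}_I\left(1-\tfrac{\beta}{1-q}\right)\right\|_{\mathrm{TV}}=0 .$$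
   Context: The open ASEP with parameters $(q,\alpha,\beta)$ on $\{1,\dots,N\}$ is the continuous-time Markov chain on $\Omega_N=\{0,1\}^N$ with generator $$\mathcal{L}f(\eta)=\sum_{x=1}^{N-1}\big(\eta(x)(1-\eta(x+1))+q\,\eta(x+1)(1-\eta(x))\big)[f(\eta^{x,x+1})-f(\eta)]+\alpha(1-\eta(1))[f(\eta^1)-f(\eta)]+\beta\eta(N)[f(\eta^N)-f(\eta)],$$ where $\eta^{x,y}$ is $\eta$ with the values at $x$ and $y$ swapped and $\eta^{w}$ is $\eta$ with the value at $w$ flipped. It has a unique stationary distribution $\mu=\mu^{N,q,\alpha,\beta}$. For an interval $I$, $\mu_I$ denotes the projection (marginal) of $\mu$ onto the coordinates in $I$, viewed as a probability measure on $\{0,1\}^{|I|}$, and $\mathrm{Ber}_I(\rho)$ denotes the Bernoulli-$\rho$ product measure on $\{0,1\}^{|I|}$. $\|\nu-\nu'\|_{\mathrm{TV}}=\frac12\sum_x|\nu(x)-\nu'(x)|$. For functions $f,g$ of $N$, $f\gg g$ means $\liminf_{N\to\infty}f(N)/g(N)=\infty$. *)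

theory Defs
  imports "HOL-Probability.Probability"
begin

text \<open>
  A configuration on a set \<open>I\<close> of sites is a function \<open>nat \<Rightarrow> bool\<close> (\<open>True\<close> meaning that the
  site is occupied) that is \<open>False\<close> outside \<open>I\<close>. With this normalisation the configurations on
  \<open>I\<close> are in bijection with \<open>{0,1}\<close>-valued functions on \<open>I\<close>, so that probability measures on them
  are probability measures on \<open>{0,1}^I\<close>.
\<close>

definition configs :: "nat set \<Rightarrow> (nat \<Rightarrow> bool) set" where
  "configs I = PiE_dflt I False (\<lambda>_. UNIV)"

definition swap_sites :: "nat \<Rightarrow> nat \<Rightarrow> (nat \<Rightarrow> bool) \<Rightarrow> nat \<Rightarrow> bool" where
  "swap_sites x y \<eta> = \<eta>(x := \<eta> y, y := \<eta> x)"

definition flip_site :: "nat \<Rightarrow> (nat \<Rightarrow> bool) \<Rightarrow> nat \<Rightarrow> bool" where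
  "flip_site x \<eta> = \<eta>(x := \<not> \<eta> x)"

definition asep_generator ::
    "nat \<Rightarrow> real \<Rightarrow> real \<Rightarrow> real \<Rightarrow> ((nat \<Rightarrow> bool) \<Rightarrow> real) \<Rightarrow> (nat \<Rightarrow> bool) \<Rightarrow> real" where
  "asep_generator N q \<alpha> \<beta> f \<eta> =
     (\<Sum>x\<in>{1..<N}.
        (of_bool (\<eta> x) * (1 - of_bool (\<eta> (x + 1)))
         + q * of_bool (\<eta> (x + 1)) * (1 - of_bool (\<eta> x)))
        * (f (swap_sites x (x + 1) \<eta>) - f \<eta>))
     + \<alpha> * (1 - of_bool (\<eta> 1)) * (f (flip_site 1 \<eta>) - f \<eta>)
     + \<beta> * of_bool (\<eta> N) * (f (flip_site N \<eta>) - f \<eta>)"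

text \<open>
  The transition semigroup \<open>exp (t L)\<close> of the chain. The state space is finite, so the exponential
  series converges at every configuration on \<open>{1..N}\<close>, see \<open>summable_asep_semigroup\<close> below.
\<close>

definition asep_semigroup ::
    "nat \<Rightarrow> real \<Rightarrow> real \<Rightarrow> real \<Rightarrow> real \<Rightarrow> ((nat \<Rightarrow> bool) \<Rightarrow> real) \<Rightarrow> (nat \<Rightarrow> bool) \<Rightarrow> real" where
  "asep_semigroup N q \<alpha> \<beta> t f \<eta> = (\<Sum>n. t ^ n / fact n * (asep_generator N q \<alpha> \<beta> ^^ n) f \<eta>)"

definition asep_stationary ::
    "nat \<Rightarrow> real \<Rightarrow> real \<Rightarrow> real \<Rightarrow> (nat \<Rightarrow> bool) pmf \<Rightarrow> bool" where
  "asep_stationary N q \<alpha> \<beta> \<mu> \<longleftrightarrow>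
     set_pmf \<mu> \<subseteq> configs {1..N} \<and>
     (\<forall>t\<ge>0. \<forall>f. measure_pmf.expectation \<mu> (asep_semigroup N q \<alpha> \<beta> t f)
                 = measure_pmf.expectation \<mu> f)"

definition marginal :: "nat set \<Rightarrow> (nat \<Rightarrow> bool) pmf \<Rightarrow> (nat \<Rightarrow> bool) pmf" where
  "marginal I \<mu> = map_pmf (\<lambda>\<eta> x. if x \<in> I then \<eta> x else False) \<mu>"

definition Ber :: "nat set \<Rightarrow> real \<Rightarrow> (nat \<Rightarrow> bool) pmf" where
  "Ber I \<rho> = Pi_pmf I False (\<lambda>_. bernoulli_pmf \<rho>)"

text \<open>Total variation distance of two probability measures carried by \<open>configs I\<close>, for finite \<open>I\<close>.\<close>

definition tv_dist :: "nat set \<Rightarrow> (nat \<Rightarrow> bool) pmf \<Rightarrow> (nat \<Rightarrow> bool) pmf \<Rightarrow> real" where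
  "tv_dist I \<nu> \<nu>' = (1 / 2) * (\<Sum>\<eta>\<in>configs I. \<bar>pmf \<nu> \<eta> - pmf \<nu>' \<eta>\<bar>)"

definition much_greater :: "(nat \<Rightarrow> real) \<Rightarrow> (nat \<Rightarrow> real) \<Rightarrow> bool"  (infix \<open>\<ggreater>\<close> 50) where
  "f \<ggreater> g \<longleftrightarrow> liminf (\<lambda>N. ereal (f N / g N)) = \<infinity>"

text \<open>The functions \<open>u(\<alpha>)\<close> and \<open>v(\<beta>)\<close> are given by one and the same formula.\<close>

definition boundary_param :: "real \<Rightarrow> real \<Rightarrow> real" where
  "boundary_param q r = (1 - q) / r - 1"

text \<open>
  The remaining facts confirm that the exponential series converges and that stationarity is the
  usual equation \<open>\<mu> L = 0\<close>.
\<close>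

lemma finite_configs: "finite I \<Longrightarrow> finite (configs I)"
  unfolding configs_def by (intro finite_PiE_dflt) auto

lemma swap_sites_configs: "\<eta> \<in> configs I \<Longrightarrow> x \<in> I \<Longrightarrow> y \<in> I \<Longrightarrow> swap_sites x y \<eta> \<in> configs I"
  by (auto simp: configs_def PiE_dflt_def swap_sites_def)

lemma flip_site_configs: "\<eta> \<in> configs I \<Longrightarrow> x \<in> I \<Longrightarrow> flip_site x \<eta> \<in> configs I"
  by (auto simp: configs_def PiE_dflt_def flip_site_def)

lemma asep_generator_bound:
  assumes "N \<ge> 1" and \<eta>: "\<eta> \<in> configs {1..N}" and f: "\<And>\<xi>. \<xi> \<in> configs {1..N} \<Longrightarrow> \<bar>f \<xi>\<bar> \<le> M"
  shows "\<bar>asep_generator N q \<alpha> \<beta> f \<eta>\<bar> \<le> 2 * (real N * (1 + \<bar>q\<bar>) + \<bar>\<alpha>\<bar> + \<bar>\<beta>\<bar>) * M"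
proof -
  have M: "M \<ge> 0" using f[OF \<eta>] by linarith
  have d: "\<bar>f \<xi> - f \<eta>\<bar> \<le> 2 * M" if "\<xi> \<in> configs {1..N}" for \<xi>
    using f[OF that] f[OF \<eta>] by linarith
  have p: "\<bar>c * (f \<xi> - f \<eta>)\<bar> \<le> C * (2 * M)" if "\<bar>c\<bar> \<le> C" "\<xi> \<in> configs {1..N}" for c C \<xi>
    unfolding abs_mult using that d[OF that(2)] by (intro mult_mono) auto
  have 1: "\<bar>\<Sum>x\<in>{1..<N}.
        (of_bool (\<eta> x) * (1 - of_bool (\<eta> (x + 1)))
         + q * of_bool (\<eta> (x + 1)) * (1 - of_bool (\<eta> x)))
        * (f (swap_sites x (x + 1) \<eta>) - f \<eta>)\<bar> \<le> (\<Sum>x\<in>{1..<N}. (1 + \<bar>q\<bar>) * (2 * M))"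
    by (rule order_trans[OF sum_abs], rule sum_mono, rule p)
       (use \<eta> in \<open>auto intro!: swap_sites_configs\<close>)
  have "(\<Sum>x\<in>{1..<N}. (1 + \<bar>q\<bar>) * (2 * M)) = (real N - 1) * ((1 + \<bar>q\<bar>) * (2 * M))"
    using \<open>N \<ge> 1\<close> by (simp add: of_nat_diff)
  also have "\<dots> \<le> real N * ((1 + \<bar>q\<bar>) * (2 * M))"
    using M by (intro mult_right_mono) auto
  finally have 2: "(\<Sum>x\<in>{1..<N}. (1 + \<bar>q\<bar>) * (2 * M)) \<le> real N * ((1 + \<bar>q\<bar>) * (2 * M))" .
  have 3: "\<bar>\<alpha> * (1 - of_bool (\<eta> 1)) * (f (flip_site 1 \<eta>) - f \<eta>)\<bar> \<le> \<bar>\<alpha>\<bar> * (2 * M)"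
    using \<open>N \<ge> 1\<close> \<eta> by (intro p) (auto intro!: flip_site_configs)
  have 4: "\<bar>\<beta> * of_bool (\<eta> N) * (f (flip_site N \<eta>) - f \<eta>)\<bar> \<le> \<bar>\<beta>\<bar> * (2 * M)"
    using \<open>N \<ge> 1\<close> \<eta> by (intro p) (auto intro!: flip_site_configs)
  have "\<bar>asep_generator N q \<alpha> \<beta> f \<eta>\<bar>
      \<le> real N * ((1 + \<bar>q\<bar>) * (2 * M)) + \<bar>\<alpha>\<bar> * (2 * M) + \<bar>\<beta>\<bar> * (2 * M)"
    unfolding asep_generator_def using 1 2 3 4 by linarith
  also have "\<dots> = 2 * (real N * (1 + \<bar>q\<bar>) + \<bar>\<alpha>\<bar> + \<bar>\<beta>\<bar>) * M"
    by (simp add: algebra_simps)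
  finally show ?thesis .
qed

lemma summable_asep_semigroup:
  assumes "N \<ge> 1" and \<eta>: "\<eta> \<in> configs {1..N}"
  shows "summable (\<lambda>n. t ^ n / fact n * (asep_generator N q \<alpha> \<beta> ^^ n) f \<eta>)"
proof -
  define C where "C = 2 * (real N * (1 + \<bar>q\<bar>) + \<bar>\<alpha>\<bar> + \<bar>\<beta>\<bar>)"
  define M where "M = (\<Sum>\<xi>\<in>configs {1..N}. \<bar>f \<xi>\<bar>)"
  have b: "\<bar>(asep_generator N q \<alpha> \<beta> ^^ n) f \<xi>\<bar> \<le> C ^ n * M" if "\<xi> \<in> configs {1..N}" for n \<xi>
    using that
  proof (induction n arbitrary: \<xi>)
    case 0
    then show ?case
      unfolding M_def using member_le_sum[of \<xi> "configs {1..N}" "\<lambda>\<xi>. \<bar>f \<xi>\<bar>"]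
      by (simp add: finite_configs)
  next
    case (Suc n)
    have "\<bar>asep_generator N q \<alpha> \<beta> ((asep_generator N q \<alpha> \<beta> ^^ n) f) \<xi>\<bar> \<le> C * (C ^ n * M)"
      unfolding C_def by (rule asep_generator_bound) (use assms Suc C_def in auto)
    then show ?case by (simp add: mult.assoc)
  qed
  have "summable (\<lambda>n. M * (inverse (fact n) * (\<bar>t\<bar> * C) ^ n))"
    by (intro summable_mult summable_exp)
  then show ?thesis
  proof (rule summable_comparison_test[rotated], intro exI allI impI)
    fix n
    have "norm (t ^ n / fact n * (asep_generator N q \<alpha> \<beta> ^^ n) f \<eta>)
        = \<bar>t\<bar> ^ n / fact n * \<bar>(asep_generator N q \<alpha> \<beta> ^^ n) f \<eta>\<bar>"
      by (simp add: abs_mult power_abs)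
    also have "\<dots> \<le> \<bar>t\<bar> ^ n / fact n * (C ^ n * M)"
      by (intro mult_left_mono b \<eta>) auto
    finally show "norm (t ^ n / fact n * (asep_generator N q \<alpha> \<beta> ^^ n) f \<eta>)
        \<le> M * (inverse (fact n) * (\<bar>t\<bar> * C) ^ n)"
      by (simp add: power_mult_distrib field_simps)
  qed
qed

lemma asep_stationary_iff:
  assumes "N \<ge> 1"
  shows "asep_stationary N q \<alpha> \<beta> \<mu> \<longleftrightarrow>
     set_pmf \<mu> \<subseteq> configs {1..N} \<and>
     (\<forall>f. measure_pmf.expectation \<mu> (asep_generator N q \<alpha> \<beta> f) = 0)"
proof (cases "set_pmf \<mu> \<subseteq> configs {1..N}")
  case True
  let ?L = "asep_generator N q \<alpha> \<beta>" and ?E = "measure_pmf.expectation \<mu>"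
  have E: "?E g = (\<Sum>\<eta>\<in>configs {1..N}. g \<eta> * pmf \<mu> \<eta>)" for g
    by (rule integral_measure_pmf_real) (use True finite_configs in auto)
  define c where "c f n = ?E ((?L ^^ n) f) / fact n" for f n
  have summand: "(\<Sum>\<eta>\<in>configs {1..N}. t ^ n / fact n * (?L ^^ n) f \<eta> * pmf \<mu> \<eta>) = c f n * t ^ n" for f t n
    by (simp add: c_def E sum_distrib_left sum_divide_distrib sum_distrib_right mult_ac)
  have sums: "(\<lambda>n. c f n * t ^ n) sums ?E (asep_semigroup N q \<alpha> \<beta> t f)" for f t
    unfolding E summand[symmetric] asep_semigroup_def
    by (intro sums_sum sums_mult2 summable_sums summable_asep_semigroup assms)
  have series: "?E (asep_semigroup N q \<alpha> \<beta> t f) = (\<Sum>n. c f n * t ^ n)" for f t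
    using sums sums_unique by blast
  have "?E (?L f) = 0" if st: "\<And>t. t \<ge> 0 \<Longrightarrow> ?E (asep_semigroup N q \<alpha> \<beta> t f) = ?E f" for f
  proof -
    have "((\<lambda>t. \<Sum>n. c f n * t ^ n) has_field_derivative (\<Sum>n. diffs (c f) n * 0 ^ n)) (at 0)"
      by (rule termdiffs_strong_converges_everywhere) (use sums sums_summable in blast)
    moreover have "(\<Sum>n. diffs (c f) n * 0 ^ n) = ?E (?L f)"
      unfolding powser_zero by (simp add: diffs_def c_def)
    ultimately have 1: "((\<lambda>t. \<Sum>n. c f n * t ^ n) has_field_derivative ?E (?L f)) (at 0 within {0..})"
      using has_field_derivative_at_within by metis
    have 2: "((\<lambda>t. \<Sum>n. c f n * t ^ n) has_field_derivative 0) (at 0 within {0..})"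
      by (rule has_field_derivative_transform_within[where f = "\<lambda>_. ?E f" and d = 1])
         (auto simp: st series[symmetric])
    show ?thesis
      by (rule has_field_derivative_unique[OF 1 2])
         (simp add: at_within_Ici_at_right)
  qed
  moreover have "?E (asep_semigroup N q \<alpha> \<beta> t f) = ?E f" if z: "\<And>f. ?E (?L f) = 0" for t f
  proof -
    have "c f n * t ^ n = (if n = 0 then ?E f else 0)" for n
      by (cases n) (simp_all add: c_def z)
    then have "(\<lambda>n. c f n * t ^ n) sums ?E f"
      using sums_single[of 0 "\<lambda>_. ?E f"] by simp
    then show ?thesis using sums sums_unique2 by blast
  qed
  ultimately show ?thesis
    using True unfolding asep_stationary_def by blast
qed (simp add: asep_stationary_def)

end

theory Submission
  imports Defs
begin

text \<open>
  Both parts squeeze the stationary measure \<open>\<mu>\<close> between a Bernoulli measure and a measure with an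
  explicit matrix product form. In the low density phase the argument runs as follows.

  Every jump of the process can be written as the application of an order preserving map to the
  configuration, the maps being chosen at constant rates. Hence the stationary measure increases, in
  the sense of expectations of increasing functions, when particles enter faster or leave more slowly
  (\<open>stationary_comparison\<close>). For \<open>\<alpha> + \<beta> = 1 - q\<close>, which is the curve \<open>uv = 1\<close>, the Bernoulli measure of
  density \<open>\<alpha> / (1 - q)\<close> is stationary (\<open>Ber_stationary\<close>). In the shock region \<open>\<alpha> + \<beta> < 1 - q\<close>, so raising
  the exit rate from \<open>\<beta>\<close> to \<open>1 - q - \<alpha>\<close> shows that \<open>\<mu>\<close> lies above this Bernoulli measure. Lowering the
  exit rate to \<open>\<beta>'\<close> gives an upper bound. The condition \<open>u v' q ^ k = 1\<close> provides the matrix algebra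
  \<open>DE - q ED = D + E\<close>, with its boundary relations, with a nonnegative representation of
  dimension \<open>k + 1\<close>: the measure for \<open>\<beta>'\<close> is a mixture of measures with at most \<open>k\<close> shocks.

  In that representation \<open>D + E\<close> is upper bidiagonal. The hypothesis \<open>u > max(1, v')\<close> says that the
  corner entry, which belongs to the region without shocks, is the strictly largest eigenvalue, and
  the left boundary vector selects that corner. The shocks are therefore pushed against the right
  boundary, and the density of this measure at \<open>x\<close> exceeds \<open>\<alpha> / (1 - q)\<close> by at most \<open>K r ^ (N - x)\<close> with \<open>r < 1\<close>
  (\<open>exists_shock_words\<close>).

  Closeness of densities suffices because of the ordering. For an event \<open>A\<close> that depends on the sites in
  \<open>I\<close> only, the indicator of \<open>A\<close> plus the number of particles in \<open>I\<close> is increasing, so the comparison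
  bounds the total variation distance on \<open>I\<close> by the sum over \<open>I\<close> of the density differences
  (\<open>tv_dist_marginal_le_density\<close>). Up to \<open>b\<close> this is a geometric sum of order \<open>r ^ (N - b)\<close>.

  The high density phase is its mirror image: exchanging particles with holes and left with right
  exchanges \<open>\<alpha>\<close> with \<open>\<beta>\<close>. The exchange is carried out on the words of the matrix product
  (\<open>word_ansatz_reflect\<close>).
\<close>

section \<open>Jumps as order preserving maps\<close>

text \<open>
  A bond carries the jump rates \<open>1\<close> to the right and \<open>q\<close> to the left. Moving the particle of a singly
  occupied bond to its right end at rate \<open>1 - q\<close> and exchanging the two sites at rate \<open>q\<close> gives the same
  rates. Both maps preserve the order of configurations, and their rates do not depend on the
  configuration.
\<close>
definition push_right :: "nat \<Rightarrow> (nat \<Rightarrow> bool) \<Rightarrow> nat \<Rightarrow> bool" where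
  "push_right x \<eta> = \<eta>(x := \<eta> x \<and> \<eta> (x + 1), x + 1 := \<eta> x \<or> \<eta> (x + 1))"

lemma generator_as_monotone_maps:
  "asep_generator N q \<alpha> \<beta> f \<eta> =
     (\<Sum>x\<in>{1..<N}. (1 - q) * (f (push_right x \<eta>) - f \<eta>) + q * (f (swap_sites x (x + 1) \<eta>) - f \<eta>))
     + \<alpha> * (f (\<eta>(1 := True)) - f \<eta>) + \<beta> * (f (\<eta>(N := False)) - f \<eta>)"
proof -
  have bond: "(of_bool (\<eta> x) * (1 - of_bool (\<eta> (x + 1)))
         + q * of_bool (\<eta> (x + 1)) * (1 - of_bool (\<eta> x))) * (f (swap_sites x (x + 1) \<eta>) - f \<eta>)
      = (1 - q) * (f (push_right x \<eta>) - f \<eta>) + q * (f (swap_sites x (x + 1) \<eta>) - f \<eta>)" for x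
  proof (cases "\<eta> x = \<eta> (x + 1)")
    case True
    then have "swap_sites x (x + 1) \<eta> = \<eta>" "push_right x \<eta> = \<eta>"
      by (auto simp: swap_sites_def push_right_def fun_eq_iff)
    then show ?thesis by simp
  next
    case False
    then have "push_right x \<eta> = (if \<eta> x then swap_sites x (x + 1) \<eta> else \<eta>)"
      by (auto simp: swap_sites_def push_right_def fun_eq_iff)
    with False show ?thesis by (cases "\<eta> x") (auto simp: algebra_simps)
  qed
  have "(1 - of_bool (\<eta> 1)) * (f (flip_site 1 \<eta>) - f \<eta>) = f (\<eta>(1 := True)) - f \<eta>"
    by (cases "\<eta> 1") (auto simp: flip_site_def fun_upd_idem)
  moreover have "of_bool (\<eta> N) * (f (flip_site N \<eta>) - f \<eta>) = f (\<eta>(N := False)) - f \<eta>"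
    by (cases "\<eta> N") (auto simp: flip_site_def fun_upd_idem)
  ultimately show ?thesis
    unfolding asep_generator_def bond by (simp add: mult.assoc)
qed

definition full :: "nat \<Rightarrow> nat \<Rightarrow> bool" where "full N x \<longleftrightarrow> x \<in> {1..N}"

text \<open>
  One step of the discrete chain that applies one of the maps, chosen with probability proportional
  to its rate. A measure is stationary for the process iff this step preserves it.
\<close>
definition uniformized ::
    "nat \<Rightarrow> real \<Rightarrow> real \<Rightarrow> real \<Rightarrow> ((nat \<Rightarrow> bool) \<Rightarrow> real) \<Rightarrow> (nat \<Rightarrow> bool) \<Rightarrow> real" where
  "uniformized N q \<alpha> \<beta> f \<eta> = f \<eta> + asep_generator N q \<alpha> \<beta> f \<eta> / (real (N - 1) + \<alpha> + \<beta>)"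

lemma le_full_iff: "\<eta> \<le> full N \<longleftrightarrow> \<eta> \<in> configs {1..N}"
  by (auto simp: full_def le_fun_def configs_def PiE_dflt_def)

lemma empty_le: "(\<lambda>_. False) \<le> (\<eta> :: nat \<Rightarrow> bool)"
  by (simp add: le_fun_def)

lemma push_right_mono: "\<eta> \<le> \<xi> \<Longrightarrow> push_right x \<eta> \<le> push_right x \<xi>"
  by (auto simp: push_right_def le_fun_def)

lemma swap_sites_mono: "\<eta> \<le> \<xi> \<Longrightarrow> swap_sites x y \<eta> \<le> swap_sites x y \<xi>"
  by (auto simp: swap_sites_def le_fun_def)

lemma fun_upd_mono: "\<eta> \<le> \<xi> \<Longrightarrow> \<eta>(x := c :: bool) \<le> \<xi>(x := c)"
  by (auto simp: le_fun_def)

locale asep_rates =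
  fixes N :: nat and q \<alpha> \<beta> :: real
  assumes N: "N \<ge> 1" and q: "0 \<le> q" "q < 1" and \<alpha>: "\<alpha> > 0" and \<beta>: "\<beta> > 0"
begin

abbreviation "P \<equiv> uniformized N q \<alpha> \<beta>"
abbreviation "rate \<equiv> real (N - 1) + \<alpha> + \<beta>"

lemma rate_pos: "rate > 0" using \<alpha> \<beta> by (simp add: add_nonneg_pos)

lemma uniformized_eq:
  "P f \<eta> = ((\<Sum>x\<in>{1..<N}. (1 - q) * f (push_right x \<eta>) + q * f (swap_sites x (x + 1) \<eta>))
     + \<alpha> * f (\<eta>(1 := True)) + \<beta> * f (\<eta>(N := False))) / rate"
proof -
  have "asep_generator N q \<alpha> \<beta> f \<eta> + rate * f \<eta>
      = (\<Sum>x\<in>{1..<N}. (1 - q) * f (push_right x \<eta>) + q * f (swap_sites x (x + 1) \<eta>))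
     + \<alpha> * f (\<eta>(1 := True)) + \<beta> * f (\<eta>(N := False))"
    unfolding generator_as_monotone_maps
    by (simp add: algebra_simps sum.distrib sum_subtractf)
  then show ?thesis using rate_pos unfolding uniformized_def by (simp add: field_simps)
qed

lemma uniformized_mono: assumes "mono f" shows "mono (P f)"
proof (rule monoI)
  fix \<eta> \<xi> :: "nat \<Rightarrow> bool" assume le: "\<eta> \<le> \<xi>"
  show "P f \<eta> \<le> P f \<xi>"
    unfolding uniformized_eq using rate_pos q \<alpha> \<beta> le
    by (intro divide_right_mono add_mono sum_mono mult_left_mono monoD[OF assms]
          push_right_mono swap_sites_mono fun_upd_mono) auto
qed

lemma uniformized_power_mono: "mono f \<Longrightarrow> mono ((P ^^ n) f)"
  by (induction n) (auto intro: uniformized_mono)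

lemma uniformized_const: "P (\<lambda>_. c) \<eta> = c"
  by (simp add: uniformized_def asep_generator_def)

lemma maps_le_full:
  assumes "\<eta> \<le> full N"
  shows "x \<in> {1..<N} \<Longrightarrow> push_right x \<eta> \<le> full N" "x \<in> {1..<N} \<Longrightarrow> swap_sites x (x + 1) \<eta> \<le> full N"
    "\<eta>(1 := True) \<le> full N" "\<eta>(N := False) \<le> full N"
  using assms N by (auto simp: full_def le_fun_def push_right_def swap_sites_def)

lemma uniformized_full_le: assumes "mono f" shows "P f (full N) \<le> f (full N)"
proof -
  have "P f (full N) \<le> P (\<lambda>_. f (full N)) (full N)"
    unfolding uniformized_eq using rate_pos q \<alpha> \<beta>
    by (intro divide_right_mono add_mono sum_mono mult_left_mono monoD[OF assms] maps_le_full) auto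
  then show ?thesis by (simp only: uniformized_const)
qed

lemma uniformized_empty_ge: assumes "mono f" shows "P f (\<lambda>_. False) \<ge> f (\<lambda>_. False)"
proof -
  have "P f (\<lambda>_. False) \<ge> P (\<lambda>_. f (\<lambda>_. False)) (\<lambda>_. False)"
    unfolding uniformized_eq using rate_pos q \<alpha> \<beta>
    by (intro divide_right_mono add_mono sum_mono mult_left_mono monoD[OF assms] empty_le) auto
  then show ?thesis by (simp only: uniformized_const)
qed

lemma uniformized_power_full_le: "mono f \<Longrightarrow> (P ^^ n) f (full N) \<le> f (full N)"
proof (induction n)
  case (Suc n)
  then show ?case using uniformized_full_le[OF uniformized_power_mono[of f n]] by auto
qed simp

lemma uniformized_power_empty_ge: "mono f \<Longrightarrow> (P ^^ n) f (\<lambda>_. False) \<ge> f (\<lambda>_. False)"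
proof (induction n)
  case (Suc n)
  then show ?case using uniformized_empty_ge[OF uniformized_power_mono[of f n]] by auto
qed simp

text \<open>
  What remains, for increasing functions, of the fact that the chain goes from \<open>\<eta>\<close> to \<open>\<xi>\<close> in \<open>n\<close> steps
  with probability at least \<open>\<epsilon>\<close>: on the rest of the probability space they are at most their value at
  the full configuration. The number \<open>\<epsilon>\<close> must not depend on the function, since the bound is iterated.
\<close>
definition leads_to :: "(nat \<Rightarrow> bool) \<Rightarrow> (nat \<Rightarrow> bool) \<Rightarrow> bool" where
  "leads_to \<eta> \<xi> \<longleftrightarrow> (\<exists>n. \<exists>\<epsilon>>0. \<epsilon> \<le> 1 \<and>
     (\<forall>f. mono f \<longrightarrow> (P ^^ n) f \<eta> \<le> (1 - \<epsilon>) * f (full N) + \<epsilon> * f \<xi>))"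

lemma leads_to_refl: "leads_to \<eta> \<eta>"
  unfolding leads_to_def by (rule exI[of _ 0], rule exI[of _ 1]) auto

lemma leads_to_trans:
  assumes "leads_to \<eta> \<xi>" "leads_to \<xi> \<zeta>" shows "leads_to \<eta> \<zeta>"
proof -
  obtain n \<epsilon> where \<epsilon>: "\<epsilon> > 0" "\<epsilon> \<le> 1"
      "\<And>f. mono f \<Longrightarrow> (P ^^ n) f \<eta> \<le> (1 - \<epsilon>) * f (full N) + \<epsilon> * f \<xi>"
    using assms(1) unfolding leads_to_def by blast
  obtain m \<delta> where \<delta>: "\<delta> > 0" "\<delta> \<le> 1"
      "\<And>f. mono f \<Longrightarrow> (P ^^ m) f \<xi> \<le> (1 - \<delta>) * f (full N) + \<delta> * f \<zeta>"
    using assms(2) unfolding leads_to_def by blast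
  have "(P ^^ (n + m)) f \<eta> \<le> (1 - \<epsilon> * \<delta>) * f (full N) + \<epsilon> * \<delta> * f \<zeta>" if f: "mono f" for f
  proof -
    have "(P ^^ (n + m)) f \<eta> = (P ^^ n) ((P ^^ m) f) \<eta>" by (simp add: funpow_add)
    also have "\<dots> \<le> (1 - \<epsilon>) * (P ^^ m) f (full N) + \<epsilon> * (P ^^ m) f \<xi>"
      by (intro \<epsilon> uniformized_power_mono f)
    also have "\<dots> \<le> (1 - \<epsilon>) * f (full N) + \<epsilon> * ((1 - \<delta>) * f (full N) + \<delta> * f \<zeta>)"
      using \<epsilon> \<delta> f uniformized_power_full_le[OF f] by (intro add_mono mult_left_mono) auto
    finally show ?thesis by (simp add: algebra_simps)
  qed
  moreover have "\<epsilon> * \<delta> > 0" "\<epsilon> * \<delta> \<le> 1" using \<epsilon> \<delta> by (auto intro: mult_le_one)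
  ultimately show ?thesis unfolding leads_to_def by blast
qed

lemma weighted_average:
  "r \<noteq> 0 \<Longrightarrow> (c * (x - y) + r * y) / r = (1 - c / r) * y + c / r * x" for c r x y :: real
  by (simp add: field_simps)

lemma leads_to_push:
  assumes x: "x \<in> {1..<N}" and \<eta>: "\<eta> \<le> full N"
  shows "leads_to \<eta> (push_right x \<eta>)"
proof -
  let ?\<epsilon> = "(1 - q) / rate"
  have "P f \<eta> \<le> (1 - ?\<epsilon>) * f (full N) + ?\<epsilon> * f (push_right x \<eta>)" if f: "mono f" for f
  proof -
    let ?F = "f (full N)"
    have bond: "(1 - q) * f (push_right y \<eta>) + q * f (swap_sites y (y + 1) \<eta>)
        \<le> (if y = x then (1 - q) * (f (push_right x \<eta>) - ?F) else 0) + ?F"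
      if y: "y \<in> {1..<N}" for y
    proof -
      have "(1 - q) * f (push_right y \<eta>) \<le> (1 - q) * ?F" "q * f (swap_sites y (y + 1) \<eta>) \<le> q * ?F"
        using q by (intro mult_left_mono monoD[OF f] maps_le_full[OF \<eta>] y; simp)+
      then show ?thesis by (auto simp: algebra_simps)
    qed
    have "P f \<eta> \<le> ((\<Sum>y\<in>{1..<N}. (if y = x then (1 - q) * (f (push_right x \<eta>) - ?F) else 0) + ?F)
          + \<alpha> * ?F + \<beta> * ?F) / rate"
      unfolding uniformized_eq using rate_pos \<alpha> \<beta>
      by (intro divide_right_mono add_mono[OF add_mono] sum_mono bond mult_left_mono
            monoD[OF f] maps_le_full[OF \<eta>]) auto
    also have "\<dots> = ((1 - q) * (f (push_right x \<eta>) - ?F) + rate * ?F) / rate"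
      using x by (simp add: sum.distrib distrib_right)
    also have "\<dots> = (1 - ?\<epsilon>) * ?F + ?\<epsilon> * f (push_right x \<eta>)"
      using rate_pos by (intro weighted_average) simp
    finally show ?thesis .
  qed
  moreover have "?\<epsilon> > 0" "?\<epsilon> \<le> 1"
    using x q \<alpha> \<beta> rate_pos by (auto simp: field_simps of_nat_diff)
  ultimately show ?thesis unfolding leads_to_def
    by (intro exI[of _ 1] exI[of _ ?\<epsilon>]) auto
qed

lemma leads_to_exit:
  assumes \<eta>: "\<eta> \<le> full N"
  shows "leads_to \<eta> (\<eta>(N := False))"
proof -
  let ?\<epsilon> = "\<beta> / rate"
  have "P f \<eta> \<le> (1 - ?\<epsilon>) * f (full N) + ?\<epsilon> * f (\<eta>(N := False))" if f: "mono f" for f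
  proof -
    let ?F = "f (full N)"
    have "P f \<eta> \<le> ((\<Sum>y\<in>{1..<N}. (1 - q) * ?F + q * ?F) + \<alpha> * ?F + \<beta> * f (\<eta>(N := False))) / rate"
      unfolding uniformized_eq using rate_pos q \<alpha> \<beta>
      by (intro divide_right_mono add_mono sum_mono mult_left_mono monoD[OF f] maps_le_full[OF \<eta>]) auto
    also have "\<dots> = (\<beta> * (f (\<eta>(N := False)) - ?F) + rate * ?F) / rate"
      by (simp add: algebra_simps)
    also have "\<dots> = (1 - ?\<epsilon>) * ?F + ?\<epsilon> * f (\<eta>(N := False))"
      using rate_pos by (intro weighted_average) simp
    finally show ?thesis .
  qed
  moreover have "?\<epsilon> > 0" "?\<epsilon> \<le> 1"
    using \<alpha> \<beta> rate_pos by (auto simp: field_simps)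
  ultimately show ?thesis unfolding leads_to_def
    by (intro exI[of _ 1] exI[of _ ?\<epsilon>]) auto
qed

text \<open>
  The rightmost particle walks to site \<open>N\<close> and leaves.
\<close>
lemma leads_to_remove_last:
  assumes "m < j" "j \<le> N"
  shows "leads_to ((full m)(j := True)) (full m)"
  using assms(2,1)
proof (induction j rule: inc_induct)
  case base
  have "(full m)(N := True) \<le> full N" using base by (auto simp: full_def le_fun_def)
  moreover have "(full m)(N := True, N := False) = full m"
    using base by (auto simp: full_def fun_eq_iff)
  ultimately show ?case using leads_to_exit by metis
next
  case (step j)
  have "(full m)(j := True) \<le> full N" using step by (auto simp: full_def le_fun_def)
  moreover have "push_right j ((full m)(j := True)) = (full m)(Suc j := True)"
    using step.prems by (auto simp: push_right_def full_def fun_eq_iff)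
  ultimately have "leads_to ((full m)(j := True)) ((full m)(Suc j := True))"
    using leads_to_push[of j "(full m)(j := True)"] step by simp
  moreover have "leads_to ((full m)(Suc j := True)) (full m)"
    using step.IH step.prems by (metis less_SucI)
  ultimately show ?case by (rule leads_to_trans)
qed

lemma leads_to_empty: "leads_to (full N) (\<lambda>_. False)"
proof -
  have "leads_to (full N) (full m)" if "m \<le> N" for m
    using that
  proof (induction m rule: inc_induct)
    case (step m)
    have "(full m)(Suc m := True) = full (Suc m)" by (auto simp: full_def fun_eq_iff)
    with leads_to_remove_last[of m "Suc m"] step show ?case by (auto intro: leads_to_trans)
  qed (rule leads_to_refl)
  moreover have "full 0 = (\<lambda>_. False)" by (auto simp: full_def)
  ultimately show ?thesis by (metis le0)
qed

text \<open>
  An increasing function takes its extreme values at the full and at the empty configuration. As the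
  chain can empty the system, \<open>n\<close> steps reduce the difference of these values by a fixed factor.
\<close>
lemma oscillation_vanishes:
  assumes f: "mono f" and e: "e > 0"
  shows "\<exists>n. (P ^^ n) f (full N) - (P ^^ n) f (\<lambda>_. False) < e"
proof -
  let ?osc = "\<lambda>f. f (full N) - f (\<lambda>_. False)"
  obtain n \<epsilon> where \<epsilon>: "\<epsilon> > 0" "\<epsilon> \<le> 1"
      "\<And>f. mono f \<Longrightarrow> (P ^^ n) f (full N) \<le> (1 - \<epsilon>) * f (full N) + \<epsilon> * f (\<lambda>_. False)"
    using leads_to_empty unfolding leads_to_def by blast
  have contract: "?osc ((P ^^ n) f) \<le> (1 - \<epsilon>) * ?osc f" if "mono f" for f
    using \<epsilon>(3)[OF that] uniformized_power_empty_ge[OF that, of n] by (simp add: algebra_simps)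
  have iter: "?osc ((P ^^ (n * m)) f) \<le> (1 - \<epsilon>) ^ m * ?osc f" for m
  proof (induction m)
    case (Suc m)
    have "?osc ((P ^^ (n * Suc m)) f) = ?osc ((P ^^ n) ((P ^^ (n * m)) f))"
      by (simp add: funpow_add)
    also have "\<dots> \<le> (1 - \<epsilon>) * ?osc ((P ^^ (n * m)) f)"
      by (intro contract uniformized_power_mono f)
    also have "\<dots> \<le> (1 - \<epsilon>) * ((1 - \<epsilon>) ^ m * ?osc f)"
      using \<epsilon> Suc by (intro mult_left_mono) auto
    finally show ?case by simp
  qed simp
  have "(\<lambda>m. (1 - \<epsilon>) ^ m * ?osc f) \<longlonglongrightarrow> 0 * ?osc f"
    using \<epsilon> by (intro tendsto_mult LIMSEQ_realpow_zero tendsto_const) auto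
  then have "eventually (\<lambda>m. (1 - \<epsilon>) ^ m * ?osc f < e) sequentially"
    using e by (intro order_tendstoD(2)[where a = e]) auto
  then obtain m where "(1 - \<epsilon>) ^ m * ?osc f < e" by (auto simp: eventually_sequentially)
  with iter[of m] show ?thesis by (intro exI[of _ "n * m"]) linarith
qed

end

section \<open>Monotonicity in the boundary rates\<close>

text \<open>
  Stationary distributions as real weights. Matrix products give such weights directly.
\<close>
definition stationary_weight ::
    "nat \<Rightarrow> real \<Rightarrow> real \<Rightarrow> real \<Rightarrow> ((nat \<Rightarrow> bool) \<Rightarrow> real) \<Rightarrow> bool" where
  "stationary_weight N q \<alpha> \<beta> w \<longleftrightarrow>
     (\<forall>\<eta>\<in>configs {1..N}. 0 \<le> w \<eta>) \<and> sum w (configs {1..N}) = 1 \<and>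
     (\<forall>f. (\<Sum>\<eta>\<in>configs {1..N}. w \<eta> * asep_generator N q \<alpha> \<beta> f \<eta>) = 0)"

text \<open>
  Let \<open>P\<close> be the step for the rates \<open>(\<alpha>, \<beta>)\<close>. On increasing functions its generator is bounded by the one
  for \<open>(\<alpha>', \<beta>')\<close>, so \<open>w'\<close> does not increase under \<open>P\<close>: the expectation of \<open>f\<close> under \<open>w'\<close> is at least that
  of \<open>P ^^ n\<close> applied to \<open>f\<close>, while \<open>w\<close> gives both the same expectation. As \<open>n\<close> grows the iterate becomes
  constant, and the two measures can no longer distinguish it.
\<close>
lemma stationary_comparison:
  assumes N: "N \<ge> 1" and q: "0 \<le> q" "q < 1"
    and \<alpha>: "0 < \<alpha>" "\<alpha> \<le> \<alpha>'" and \<beta>: "\<beta>' \<le> \<beta>" "0 < \<beta>"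
    and w: "stationary_weight N q \<alpha> \<beta> w" and w': "stationary_weight N q \<alpha>' \<beta>' w'"
    and f: "mono f"
  shows "(\<Sum>\<eta>\<in>configs {1..N}. w \<eta> * f \<eta>) \<le> (\<Sum>\<eta>\<in>configs {1..N}. w' \<eta> * f \<eta>)"
proof -
  interpret asep_rates N q \<alpha> \<beta> by unfold_locales (use assms in auto)
  let ?S = "configs {1..N}"
  let ?E = "\<lambda>w f. \<Sum>\<eta>\<in>?S. w \<eta> * (f \<eta> :: real)"
  have step: "?E x (P g) = ?E x g + ?E x (asep_generator N q \<alpha> \<beta> g) / rate" for x g
    by (simp add: uniformized_def algebra_simps sum.distrib sum_divide_distrib)
  have inv: "?E w (P g) = ?E w g" for g
    using w step[of w] by (simp add: stationary_weight_def)
  have w_n: "?E w ((P ^^ n) f) = ?E w f" for n by (induction n) (simp_all only: funpow.simps id_apply o_apply inv)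
  have decr: "?E w' (P g) \<le> ?E w' g" if g: "mono g" for g
  proof -
    have "asep_generator N q \<alpha> \<beta> g \<eta> \<le> asep_generator N q \<alpha>' \<beta>' g \<eta>" for \<eta>
    proof -
      have "\<alpha> * (g (\<eta>(1 := True)) - g \<eta>) \<le> \<alpha>' * (g (\<eta>(1 := True)) - g \<eta>)"
        using assms by (intro mult_right_mono) (auto intro!: monoD[OF g] simp: le_fun_def)
      moreover have "\<beta> * (g (\<eta>(N := False)) - g \<eta>) \<le> \<beta>' * (g (\<eta>(N := False)) - g \<eta>)"
        using assms by (intro mult_right_mono_neg) (auto intro!: monoD[OF g] simp: le_fun_def split: if_splits)
      ultimately show ?thesis unfolding generator_as_monotone_maps by linarith
    qed
    then have "?E w' (asep_generator N q \<alpha> \<beta> g) \<le> ?E w' (asep_generator N q \<alpha>' \<beta>' g)"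
      using w' by (intro sum_mono mult_left_mono) (auto simp: stationary_weight_def)
    also have "\<dots> = 0" using w' by (simp add: stationary_weight_def)
    finally show ?thesis using step[of w'] rate_pos by (simp add: divide_nonpos_pos)
  qed
  have w'_n: "?E w' ((P ^^ n) f) \<le> ?E w' f" for n
  proof (induction n)
    case (Suc n)
    then show ?case using decr[OF uniformized_power_mono[OF f, of n]] by simp
  qed simp
  have "?E w f \<le> ?E w' f + e" if e: "e > 0" for e
  proof -
    obtain n where n: "(P ^^ n) f (full N) - (P ^^ n) f (\<lambda>_. False) < e"
      using oscillation_vanishes[OF f e] by blast
    let ?g = "(P ^^ n) f"
    have g: "mono ?g" by (intro uniformized_power_mono f)
    have "?E w ?g \<le> ?E w (\<lambda>_. ?g (full N))"
      using w by (intro sum_mono mult_left_mono monoD[OF g]) (auto simp: le_full_iff stationary_weight_def)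
    also have "\<dots> = ?g (full N)"
      using w by (simp flip: sum_distrib_right add: stationary_weight_def)
    finally have 1: "?E w f \<le> ?g (full N)" by (simp only: w_n)
    have "?g (\<lambda>_. False) = ?E w' (\<lambda>_. ?g (\<lambda>_. False))"
      using w' by (simp flip: sum_distrib_right add: stationary_weight_def)
    also have "\<dots> \<le> ?E w' ?g"
      using w' by (intro sum_mono mult_left_mono monoD[OF g]) (auto simp: le_fun_def stationary_weight_def)
    finally have 2: "?g (\<lambda>_. False) \<le> ?E w' f" using w'_n[of n] by linarith
    from 1 2 n show ?thesis by linarith
  qed
  then show ?thesis by (rule field_le_epsilon)
qed

lemma stationary_weight_pmf:
  assumes "N \<ge> 1" and "asep_stationary N q \<alpha> \<beta> \<mu>"
  shows "stationary_weight N q \<alpha> \<beta> (pmf \<mu>)"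
proof -
  have supp: "set_pmf \<mu> \<subseteq> configs {1..N}"
    and 0: "measure_pmf.expectation \<mu> (asep_generator N q \<alpha> \<beta> f) = 0" for f
    using assms asep_stationary_iff by blast+
  have "measure_pmf.expectation \<mu> g = (\<Sum>\<eta>\<in>configs {1..N}. pmf \<mu> \<eta> * g \<eta>)" for g :: "_ \<Rightarrow> real"
    using supp by (subst integral_measure_pmf_real[where A = "configs {1..N}"])
      (auto simp: finite_configs mult.commute)
  then show ?thesis
    using supp 0 unfolding stationary_weight_def
    by (auto simp: sum_pmf_eq_1 finite_configs)
qed

section \<open>Total variation distance from densities\<close>

definition restrict_config :: "nat set \<Rightarrow> (nat \<Rightarrow> bool) \<Rightarrow> nat \<Rightarrow> bool" where
  "restrict_config I \<eta> x \<longleftrightarrow> x \<in> I \<and> \<eta> x"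

text \<open>
  Adding a particle in \<open>I\<close> changes an indicator by at least \<open>-1\<close> and the number of particles by \<open>1\<close>.
\<close>
lemma mono_bounded_plus_count:
  fixes I :: "nat set"
  assumes "finite I"
  shows "mono (\<lambda>\<eta>. of_bool (restrict_config I \<eta> \<in> S) + (\<Sum>x\<in>I. of_bool (\<eta> x) :: real))"
proof (rule monoI)
  fix \<eta> \<xi> :: "nat \<Rightarrow> bool" assume le: "\<eta> \<le> \<xi>"
  show "of_bool (restrict_config I \<eta> \<in> S) + (\<Sum>x\<in>I. of_bool (\<eta> x) :: real)
      \<le> of_bool (restrict_config I \<xi> \<in> S) + (\<Sum>x\<in>I. of_bool (\<xi> x))"
  proof (cases "\<exists>y\<in>I. \<xi> y \<and> \<not> \<eta> y")
    case True
    then obtain y where y: "y \<in> I" "\<xi> y" "\<not> \<eta> y" by blast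
    have "(\<Sum>x\<in>I. of_bool (\<eta> x) + (if x = y then 1 else 0 :: real)) \<le> (\<Sum>x\<in>I. of_bool (\<xi> x))"
      using le y by (intro sum_mono) (auto simp: le_fun_def)
    then have "(\<Sum>x\<in>I. of_bool (\<eta> x) :: real) + 1 \<le> (\<Sum>x\<in>I. of_bool (\<xi> x))"
      using assms y by (simp add: sum.distrib del: sum_of_bool_eq)
    then show ?thesis by (auto simp del: sum_of_bool_eq)
  next
    case False
    with le have eq: "\<And>x. x \<in> I \<Longrightarrow> \<eta> x = \<xi> x" by (auto simp: le_fun_def)
    then have "restrict_config I \<eta> = restrict_config I \<xi>"
      by (auto simp: restrict_config_def fun_eq_iff)
    with eq show ?thesis by (simp del: sum_of_bool_eq)
  qed
qed

lemma tv_dist_sym: "tv_dist I \<mu> \<nu> = tv_dist I \<nu> \<mu>"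
  by (simp add: tv_dist_def abs_minus_commute)

lemma sum_marginal:
  assumes "finite J" "set_pmf \<mu> \<subseteq> configs J" "S \<subseteq> configs I" "finite I"
  shows "(\<Sum>\<xi>\<in>S. pmf (marginal I \<mu>) \<xi>)
    = (\<Sum>\<eta>\<in>configs J. pmf \<mu> \<eta> * of_bool (restrict_config I \<eta> \<in> S))"
proof -
  have fin: "finite S" using assms finite_configs finite_subset by blast
  have "marginal I \<mu> = map_pmf (restrict_config I) \<mu>"
    unfolding marginal_def restrict_config_def by (intro map_pmf_cong) auto
  then have "(\<Sum>\<xi>\<in>S. pmf (marginal I \<mu>) \<xi>) = measure_pmf.prob \<mu> (restrict_config I -` S)"
    using fin by (simp add: measure_measure_pmf_finite[symmetric])
  also have "\<dots> = measure_pmf.prob \<mu> (restrict_config I -` S \<inter> configs J)"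
  proof -
    have "restrict_config I -` S \<inter> set_pmf \<mu> = restrict_config I -` S \<inter> configs J \<inter> set_pmf \<mu>"
      using assms by auto
    then show ?thesis by (metis measure_Int_set_pmf)
  qed
  also have "\<dots> = (\<Sum>\<eta>\<in>restrict_config I -` S \<inter> configs J. pmf \<mu> \<eta>)"
    using assms by (intro measure_measure_pmf_finite) (auto simp: finite_configs)
  also have "\<dots> = (\<Sum>\<eta>\<in>configs J. pmf \<mu> \<eta> * of_bool (restrict_config I \<eta> \<in> S))"
    using assms by (intro sum.mono_neutral_cong_left) (auto simp: finite_configs)
  finally show ?thesis .
qed

lemma set_pmf_marginal: "set_pmf (marginal I \<mu>) \<subseteq> configs I"
  by (auto simp: marginal_def configs_def PiE_dflt_def)

text \<open>
  The distance is the difference of the probabilities of one event, the set where the second marginal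
  has the larger mass. Domination is applied to its indicator plus the number of particles in \<open>I\<close>. This
  takes the place of a coupling in which the two configurations are ordered and differ on \<open>I\<close> with
  probability at most the expected number of sites at which they differ.
\<close>
lemma tv_dist_marginal_le_density:
  assumes J: "finite J" "I \<subseteq> J" and supp: "set_pmf \<mu> \<subseteq> configs J" "set_pmf \<nu> \<subseteq> configs J"
    and dom: "\<And>f :: _ \<Rightarrow> real. mono f \<Longrightarrow>
        (\<Sum>\<eta>\<in>configs J. pmf \<nu> \<eta> * f \<eta>) \<le> (\<Sum>\<eta>\<in>configs J. pmf \<mu> \<eta> * f \<eta>)"
  shows "tv_dist I (marginal I \<mu>) (marginal I \<nu>)
    \<le> (\<Sum>x\<in>I. (\<Sum>\<eta>\<in>configs J. pmf \<mu> \<eta> * of_bool (\<eta> x)) - (\<Sum>\<eta>\<in>configs J. pmf \<nu> \<eta> * of_bool (\<eta> x)))"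
proof -
  have I: "finite I" using J finite_subset by blast
  let ?m = "pmf (marginal I \<mu>)" and ?n = "pmf (marginal I \<nu>)" and ?C = "configs I"
  let ?S = "{\<xi>\<in>?C. ?m \<xi> < ?n \<xi>}"
  let ?E = "\<lambda>\<mu> f. \<Sum>\<eta>\<in>configs J. pmf \<mu> \<eta> * (f \<eta> :: real)"
  have one: "sum ?m ?C = 1" "sum ?n ?C = 1"
    by (intro sum_pmf_eq_1 finite_configs I set_pmf_marginal)+
  have "(\<Sum>\<xi>\<in>?C. \<bar>?m \<xi> - ?n \<xi>\<bar>) = (\<Sum>\<xi>\<in>?C. 2 * (if ?m \<xi> < ?n \<xi> then ?n \<xi> - ?m \<xi> else 0) + (?m \<xi> - ?n \<xi>))"
    by (intro sum.cong) auto
  also have "\<dots> = 2 * (\<Sum>\<xi>\<in>?C. if ?m \<xi> < ?n \<xi> then ?n \<xi> - ?m \<xi> else 0)"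
    by (simp add: sum.distrib sum_subtractf one flip: sum_distrib_left)
  also have "(\<Sum>\<xi>\<in>?C. if ?m \<xi> < ?n \<xi> then ?n \<xi> - ?m \<xi> else 0) = sum ?n ?S - sum ?m ?S"
    by (simp add: sum.If_cases finite_configs I sum_subtractf Int_def)
  finally have "tv_dist I (marginal I \<mu>) (marginal I \<nu>) = sum ?n ?S - sum ?m ?S"
    by (simp add: tv_dist_def)
  also have "\<dots> = ?E \<nu> (\<lambda>\<eta>. of_bool (restrict_config I \<eta> \<in> ?S)) - ?E \<mu> (\<lambda>\<eta>. of_bool (restrict_config I \<eta> \<in> ?S))"
    using J I supp by (subst (1 2) sum_marginal[where J = J]) auto
  also have "\<dots> \<le> ?E \<mu> (\<lambda>\<eta>. \<Sum>x\<in>I. of_bool (\<eta> x)) - ?E \<nu> (\<lambda>\<eta>. \<Sum>x\<in>I. of_bool (\<eta> x))"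
    using dom[OF mono_bounded_plus_count[OF I, of ?S]]
    by (simp add: distrib_left sum.distrib del: sum_of_bool_eq)
  also have "\<dots> = (\<Sum>x\<in>I. ?E \<mu> (\<lambda>\<eta>. of_bool (\<eta> x)) - ?E \<nu> (\<lambda>\<eta>. of_bool (\<eta> x)))"
    unfolding sum_subtractf sum_distrib_left
    by (subst (1 2) sum.swap) (rule refl)
  finally show ?thesis .
qed

section \<open>Matrix products\<close>

text \<open>
  The relations \<open>DE - q ED = D + E\<close>, \<open>\<alpha> \<langle>W|E = \<langle>W|\<close> and \<open>\<beta> D|V\<rangle> = |V\<rangle>\<close> of Derrida, Evans, Hakim and
  Pasquier, read off from the values \<open>\<langle>W|X\<^sub>1 \<dots> X\<^sub>n|V\<rangle>\<close> of words in \<open>D\<close> (\<open>True\<close>) and \<open>E\<close> (\<open>False\<close>).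
  Stating them without reference to a vector space lets scalars, matrices and reflected words be
  treated alike.
\<close>
definition word_ansatz :: "real \<Rightarrow> real \<Rightarrow> real \<Rightarrow> (bool list \<Rightarrow> real) \<Rightarrow> bool" where
  "word_ansatz q \<alpha> \<beta> W \<longleftrightarrow>
     (\<forall>pre suf. W (pre @ [True, False] @ suf) - q * W (pre @ [False, True] @ suf)
        = W (pre @ [True] @ suf) + W (pre @ [False] @ suf)) \<and>
     (\<forall>suf. \<alpha> * W (False # suf) = W suf) \<and>
     (\<forall>pre. \<beta> * W (pre @ [True]) = W pre)"

definition word_of :: "nat \<Rightarrow> (nat \<Rightarrow> bool) \<Rightarrow> bool list" where
  "word_of N \<eta> = map \<eta> [1..<Suc N]"

lemma sum_configs_involution:
  fixes h :: "(nat \<Rightarrow> bool) \<Rightarrow> real"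
  assumes "\<And>\<eta>. \<eta> \<in> configs J \<Longrightarrow> \<phi> \<eta> \<in> configs J" "\<And>\<eta>. \<phi> (\<phi> \<eta>) = \<eta>"
  shows "(\<Sum>\<eta>\<in>configs J. h (\<phi> \<eta>)) = (\<Sum>\<eta>\<in>configs J. h \<eta>)"
  by (rule sum.reindex_bij_witness[where i = \<phi> and j = \<phi>]) (use assms in auto)

text \<open>
  For each configuration \<open>\<eta>\<close> let \<open>R x \<eta>\<close> be the value of its word with site \<open>x\<close> deleted, with sign \<open>-\<close> if
  \<open>x\<close> is occupied and \<open>+\<close> if it is empty. The bulk relation says that the net flow of weight into \<open>\<eta>\<close>
  across the bond \<open>{x, x + 1}\<close> is \<open>R x \<eta> - R (x + 1) \<eta>\<close>. The sum over the bonds telescopes to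
  \<open>R 1 \<eta> - R N \<eta>\<close>, and the boundary relations say that the flows at the two ends cancel these terms.
\<close>
lemma word_ansatz_stationary:
  assumes N: "N \<ge> 1" and W: "word_ansatz q \<alpha> \<beta> W"
  shows "(\<Sum>\<eta>\<in>configs {1..N}. W (word_of N \<eta>) * asep_generator N q \<alpha> \<beta> f \<eta>) = 0"
proof -
  let ?C = "configs {1..N}"
  define w where "w \<eta> = W (word_of N \<eta>)" for \<eta>
  define c where "c x \<eta> = of_bool (\<eta> x) * (1 - of_bool (\<eta> (x + 1)))
         + q * of_bool (\<eta> (x + 1)) * (1 - of_bool (\<eta> x))" for x and \<eta> :: "nat \<Rightarrow> bool"
  define R where "R x \<eta> = (if \<eta> x then -1 else 1) * W (map \<eta> [1..<x] @ map \<eta> [Suc x..<Suc N])"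
    for x and \<eta> :: "nat \<Rightarrow> bool"
  have bulk: "W (pre @ True # False # suf) - q * W (pre @ False # True # suf)
        = W (pre @ True # suf) + W (pre @ False # suf)" for pre suf
    using W by (simp add: word_ansatz_def)
  have split: "map \<eta> [1..<Suc N] = map \<eta> [1..<x] @ \<eta> x # map \<eta> [Suc x..<Suc N]"
    if "x \<in> {1..N}" for x and \<eta> :: "nat \<Rightarrow> bool"
  proof -
    have "[1..<Suc N] = [1..<x] @ x # [Suc x..<Suc N]"
      using that upt_conv_Cons[of x "Suc N"] upt_add_eq_append[of 1 x "Suc N - x"] by auto
    then show ?thesis by simp
  qed
  have bond: "(\<Sum>\<eta>\<in>?C. w \<eta> * (c x \<eta> * (f (swap_sites x (x + 1) \<eta>) - f \<eta>)))
      = (\<Sum>\<eta>\<in>?C. f \<eta> * (R x \<eta> - R (Suc x) \<eta>))" if x: "x \<in> {1..<N}" for x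
  proof -
    let ?s = "swap_sites x (x + 1)"
    have inv: "?s (?s \<eta>) = \<eta>" for \<eta> by (auto simp: swap_sites_def)
    have eq: "w (?s \<eta>) * c x (?s \<eta>) - w \<eta> * c x \<eta> = R x \<eta> - R (Suc x) \<eta>" for \<eta>
    proof -
      define pre suf where "pre = map \<eta> [1..<x]" and "suf = map \<eta> [Suc (Suc x)..<Suc N]"
      have tail: "[Suc x..<Suc N] = Suc x # [Suc (Suc x)..<Suc N]"
        using x upt_conv_Cons[of "Suc x" "Suc N"] by auto
      have pre': "map (?s \<eta>) [1..<x] = pre" and suf': "map (?s \<eta>) [Suc (Suc x)..<Suc N] = suf"
        by (auto simp: pre_def suf_def swap_sites_def)
      have x': "x \<in> {1..N}" using x by simp
      have swapped: "?s \<eta> x = \<eta> (Suc x)" "?s \<eta> (Suc x) = \<eta> x"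
        by (auto simp: swap_sites_def)
      have "w \<eta> = W (pre @ \<eta> x # \<eta> (Suc x) # suf)"
        using x unfolding w_def word_of_def
        by (subst split[of x]) (auto simp: tail pre_def suf_def simp del: upt_Suc)
      moreover have "w (?s \<eta>) = W (pre @ \<eta> (Suc x) # \<eta> x # suf)"
        using split[of x "?s \<eta>"] x'
        by (simp only: w_def word_of_def tail list.map pre' suf' swapped)
      moreover have "R x \<eta> = (if \<eta> x then -1 else 1) * W (pre @ \<eta> (Suc x) # suf)"
        unfolding R_def tail by (simp add: pre_def suf_def del: upt_Suc)
      moreover have "R (Suc x) \<eta> = (if \<eta> (Suc x) then -1 else 1) * W (pre @ \<eta> x # suf)"
        using x unfolding R_def by (simp add: pre_def suf_def del: upt_Suc) (simp)
      moreover have "c x (?s \<eta>) = of_bool (\<eta> (Suc x)) * (1 - of_bool (\<eta> x))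
         + q * of_bool (\<eta> x) * (1 - of_bool (\<eta> (Suc x)))"
        using swapped by (simp add: c_def)
      ultimately show ?thesis
        using bulk[of pre suf] unfolding c_def
        by (cases "\<eta> x"; cases "\<eta> (Suc x)") (auto simp: algebra_simps)
    qed
    have "(\<Sum>\<eta>\<in>?C. w \<eta> * c x \<eta> * f (?s \<eta>)) = (\<Sum>\<eta>\<in>?C. w (?s \<eta>) * c x (?s \<eta>) * f \<eta>)"
      using sum_configs_involution[of "{1..N}" ?s "\<lambda>\<eta>. w (?s \<eta>) * c x (?s \<eta>) * f \<eta>"] x
      by (simp add: inv swap_sites_configs del: One_nat_def)
    then have "(\<Sum>\<eta>\<in>?C. w \<eta> * (c x \<eta> * (f (?s \<eta>) - f \<eta>)))
        = (\<Sum>\<eta>\<in>?C. w (?s \<eta>) * c x (?s \<eta>) * f \<eta>) - (\<Sum>\<eta>\<in>?C. w \<eta> * c x \<eta> * f \<eta>)"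
      by (simp add: algebra_simps sum_subtractf)
    also have "\<dots> = (\<Sum>\<eta>\<in>?C. f \<eta> * (R x \<eta> - R (Suc x) \<eta>))"
      by (simp add: eq[symmetric] sum_subtractf[symmetric] algebra_simps)
    finally show ?thesis .
  qed
  have flip: "(\<Sum>\<eta>\<in>?C. w \<eta> * (r \<eta> * (f (flip_site x \<eta>) - f \<eta>)))
      = (\<Sum>\<eta>\<in>?C. f \<eta> * (w (flip_site x \<eta>) * r (flip_site x \<eta>) - w \<eta> * r \<eta>))"
    if x: "x \<in> {1..N}" for x r
  proof -
    have inv: "flip_site x (flip_site x \<eta>) = \<eta>" for \<eta> by (auto simp: flip_site_def)
    have "(\<Sum>\<eta>\<in>?C. w \<eta> * r \<eta> * f (flip_site x \<eta>))
        = (\<Sum>\<eta>\<in>?C. w (flip_site x \<eta>) * r (flip_site x \<eta>) * f \<eta>)"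
      using sum_configs_involution[of "{1..N}" "flip_site x"
          "\<lambda>\<eta>. w (flip_site x \<eta>) * r (flip_site x \<eta>) * f \<eta>"] x
      by (simp add: inv flip_site_configs del: One_nat_def)
    then show ?thesis by (simp add: algebra_simps sum_subtractf)
  qed
  have left: "w (flip_site 1 \<eta>) * (\<alpha> * (1 - of_bool (flip_site 1 \<eta> 1)))
      - w \<eta> * (\<alpha> * (1 - of_bool (\<eta> 1))) = - R 1 \<eta>" for \<eta>
  proof -
    have "map (flip_site 1 \<eta>) [Suc 1..<Suc N] = map \<eta> [Suc 1..<Suc N]"
      by (auto simp: flip_site_def)
    then have "w (flip_site 1 \<eta>) = W ((\<not> \<eta> 1) # map \<eta> [Suc 1..<Suc N])"
      unfolding w_def word_of_def using N
      by (subst split[of 1]) (auto simp: flip_site_def simp del: upt_Suc)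
    moreover have "w \<eta> = W (\<eta> 1 # map \<eta> [Suc 1..<Suc N])"
      unfolding w_def word_of_def using N by (subst split[of 1]) (auto simp del: upt_Suc)
    ultimately show ?thesis
      using W unfolding R_def word_ansatz_def
      by (cases "\<eta> 1") (auto simp: flip_site_def mult_ac simp del: upt_Suc)
  qed
  have right: "w (flip_site N \<eta>) * (\<beta> * of_bool (flip_site N \<eta> N))
      - w \<eta> * (\<beta> * of_bool (\<eta> N)) = R N \<eta>" for \<eta>
  proof -
    have "map (flip_site N \<eta>) [1..<N] = map \<eta> [1..<N]"
      by (auto simp: flip_site_def)
    then have "w (flip_site N \<eta>) = W (map \<eta> [1..<N] @ [\<not> \<eta> N])"
      unfolding w_def word_of_def using N
      by (subst split[of N]) (auto simp: flip_site_def)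
    moreover have "w \<eta> = W (map \<eta> [1..<N] @ [\<eta> N])"
      unfolding w_def word_of_def using N by (subst split[of N]) auto
    ultimately show ?thesis
      using W unfolding R_def word_ansatz_def
      by (cases "\<eta> N") (auto simp: flip_site_def mult_ac)
  qed
  have telescope: "(\<Sum>x\<in>{1..<N}. R x \<eta> - R (Suc x) \<eta>) = R 1 \<eta> - R N \<eta>" for \<eta>
    using N sum_Suc_diff'[of 1 N "\<lambda>x. - R x \<eta>"] by (simp add: algebra_simps)
  have "(\<Sum>\<eta>\<in>?C. w \<eta> * asep_generator N q \<alpha> \<beta> f \<eta>)
     = (\<Sum>\<eta>\<in>?C. \<Sum>x\<in>{1..<N}. w \<eta> * (c x \<eta> * (f (swap_sites x (x + 1) \<eta>) - f \<eta>)))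
     + (\<Sum>\<eta>\<in>?C. w \<eta> * (\<alpha> * (1 - of_bool (\<eta> 1)) * (f (flip_site 1 \<eta>) - f \<eta>)))
     + (\<Sum>\<eta>\<in>?C. w \<eta> * (\<beta> * of_bool (\<eta> N) * (f (flip_site N \<eta>) - f \<eta>)))"
    unfolding asep_generator_def c_def[symmetric]
    by (simp only: distrib_left sum.distrib sum_distrib_left)
  also have "(\<Sum>\<eta>\<in>?C. \<Sum>x\<in>{1..<N}. w \<eta> * (c x \<eta> * (f (swap_sites x (x + 1) \<eta>) - f \<eta>)))
      = (\<Sum>x\<in>{1..<N}. \<Sum>\<eta>\<in>?C. f \<eta> * (R x \<eta> - R (Suc x) \<eta>))"
    by (subst sum.swap) (rule sum.cong[OF refl bond])
  also have "\<dots> = (\<Sum>\<eta>\<in>?C. f \<eta> * (\<Sum>x\<in>{1..<N}. R x \<eta> - R (Suc x) \<eta>))"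
    by (subst sum.swap) (simp only: sum_distrib_left)
  also have "\<dots> = (\<Sum>\<eta>\<in>?C. f \<eta> * (R 1 \<eta> - R N \<eta>))"
    by (simp only: telescope)
  also have "(\<Sum>\<eta>\<in>?C. w \<eta> * (\<alpha> * (1 - of_bool (\<eta> 1)) * (f (flip_site 1 \<eta>) - f \<eta>)))
      = (\<Sum>\<eta>\<in>?C. f \<eta> * - R 1 \<eta>)"
    using N by (subst flip) (auto simp only: left atLeastAtMost_iff le_refl)
  also have "(\<Sum>\<eta>\<in>?C. w \<eta> * (\<beta> * of_bool (\<eta> N) * (f (flip_site N \<eta>) - f \<eta>)))
      = (\<Sum>\<eta>\<in>?C. f \<eta> * R N \<eta>)"
    using N by (subst flip) (auto simp only: right atLeastAtMost_iff le_refl)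
  finally show ?thesis
    by (simp add: w_def algebra_simps sum_subtractf sum_negf)
qed

text \<open>
  Reversal and complementation each turn \<open>DE\<close> into \<open>ED\<close>, so together they preserve the bulk relation;
  they exchange the two boundary relations.
\<close>
lemma word_ansatz_reflect:
  assumes "word_ansatz q \<alpha> \<beta> W"
  shows "word_ansatz q \<beta> \<alpha> (\<lambda>xs. W (rev (map Not xs)))"
  using assms unfolding word_ansatz_def by (simp add: add.commute)

definition words :: "nat \<Rightarrow> bool list set" where "words n = {xs. length xs = n}"

lemma finite_words: "finite (words n)"
  using finite_lists_length_eq[of "UNIV :: bool set" n] by (simp add: words_def)

lemma word_of_nth: "x \<in> {1..N} \<Longrightarrow> word_of N \<eta> ! (x - 1) = \<eta> x"
  by (auto simp: word_of_def simp del: upt_Suc)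

lemma bij_betw_word_of: "bij_betw (word_of N) (configs {1..N}) (words N)"
proof (rule bij_betwI[where g = "\<lambda>xs x. x \<in> {1..N} \<and> xs ! (x - 1)"])
  fix \<eta> assume "\<eta> \<in> configs {1..N}"
  then have "\<eta> x \<longleftrightarrow> x \<in> {1..N} \<and> \<eta> x" for x
    by (auto simp: configs_def PiE_dflt_def)
  then show "(\<lambda>x. x \<in> {1..N} \<and> word_of N \<eta> ! (x - 1)) = \<eta>"
    using word_of_nth[of _ N \<eta>] by blast
next
  fix xs assume "xs \<in> words N"
  then show "word_of N (\<lambda>x. x \<in> {1..N} \<and> xs ! (x - 1)) = xs"
    by (intro nth_equalityI) (auto simp: word_of_def words_def simp del: upt_Suc)
qed (auto simp: configs_def PiE_dflt_def word_of_def words_def)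

lemma sum_configs_words:
  "(\<Sum>\<eta>\<in>configs {1..N}. F (word_of N \<eta>)) = (\<Sum>xs\<in>words N. F xs :: real)"
  by (rule sum.reindex_bij_betw[OF bij_betw_word_of])

lemma stationary_weight_of_words:
  assumes N: "N \<ge> 1" and W: "word_ansatz q \<alpha> \<beta> W"
    and nonneg: "\<And>xs. length xs = N \<Longrightarrow> 0 \<le> W xs" and Z: "(\<Sum>xs\<in>words N. W xs) > 0"
  shows "stationary_weight N q \<alpha> \<beta> (\<lambda>\<eta>. W (word_of N \<eta>) / (\<Sum>xs\<in>words N. W xs))"
  unfolding stationary_weight_def
  using word_ansatz_stationary[OF N W] nonneg Z sum_configs_words[of W N]
  by (auto simp: word_of_def sum_divide_distrib[symmetric] simp del: upt_Suc)

lemma sum_words_Suc: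
  "(\<Sum>xs\<in>words (Suc n). F xs) = (\<Sum>xs\<in>words n. F (True # xs) + F (False # xs) :: real)"
proof -
  have "words (Suc n) = (#) True ` words n \<union> (#) False ` words n"
    by (auto simp: words_def length_Suc_conv image_iff)
  moreover have "sum F ((#) True ` words n \<union> (#) False ` words n)
      = sum F ((#) True ` words n) + sum F ((#) False ` words n)"
    by (rule sum.union_disjoint) (auto simp: finite_words)
  ultimately show ?thesis by (simp add: sum.reindex sum.distrib)
qed

lemma words_0: "words 0 = {[]}" by (auto simp: words_def)

lemma sum_words_reflect: "(\<Sum>xs\<in>words n. F (rev (map Not xs))) = (\<Sum>xs\<in>words n. F xs :: real)"
  by (rule sum.reindex_bij_witness[where i = "\<lambda>xs. rev (map Not xs)" and j = "\<lambda>xs. rev (map Not xs)"])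
     (auto simp: words_def rev_map comp_def)

section \<open>The product measure on the curve without shocks\<close>

text \<open>
  The one-dimensional representation \<open>D = 1 / \<beta>\<close>, \<open>E = 1 / \<alpha>\<close>: the bulk relation becomes
  \<open>(1 - q) / (\<alpha> \<beta>) = 1 / \<alpha> + 1 / \<beta>\<close>.
\<close>
lemma Ber_stationary:
  assumes N: "N \<ge> 1" and \<alpha>: "\<alpha> > 0" and \<beta>: "\<beta> > 0" and sum: "\<alpha> + \<beta> = 1 - q"
  shows "stationary_weight N q \<alpha> \<beta> (pmf (Ber {1..N} (\<alpha> / (1 - q))))"
proof -
  define \<rho> where "\<rho> = \<alpha> / (1 - q)"
  have \<rho>: "0 \<le> \<rho>" "\<rho> \<le> 1" "\<beta> / (1 - q) = 1 - \<rho>"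
    using \<alpha> \<beta> sum by (auto simp: \<rho>_def field_simps)
  define W :: "bool list \<Rightarrow> real" where "W xs = prod_list (map (\<lambda>b. if b then 1 / \<beta> else 1 / \<alpha>) xs)" for xs
  have "word_ansatz q \<alpha> \<beta> W"
    unfolding word_ansatz_def
  proof (intro conjI allI)
    fix pre suf
    define r where "r = 1 / \<alpha> * (1 / \<beta>)"
    have rel: "(1 - q) * r = 1 / \<beta> + 1 / \<alpha>"
      using \<alpha> \<beta> by (simp add: r_def sum[symmetric] field_simps)
    have "W (pre @ [True, False] @ suf) = W pre * W suf * r"
      "W (pre @ [False, True] @ suf) = W pre * W suf * r"
      by (simp_all add: W_def r_def)
    then have "W (pre @ [True, False] @ suf) - q * W (pre @ [False, True] @ suf)
      = W pre * W suf * ((1 - q) * r)"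
      by (simp only: left_diff_distrib right_diff_distrib) simp
    also have "\<dots> = W (pre @ [True] @ suf) + W (pre @ [False] @ suf)"
      unfolding rel by (simp add: W_def algebra_simps)
    finally show "W (pre @ [True, False] @ suf) - q * W (pre @ [False, True] @ suf)
      = W (pre @ [True] @ suf) + W (pre @ [False] @ suf)" .
  qed (use \<alpha> \<beta> in \<open>auto simp: W_def\<close>)
  then have eq0: "(\<Sum>\<eta>\<in>configs {1..N}. W (word_of N \<eta>) * asep_generator N q \<alpha> \<beta> f \<eta>) = 0" for f
    by (rule word_ansatz_stationary[OF N])
  define c where "c = \<alpha> * \<beta> / (1 - q)"
  have "pmf (Ber {1..N} \<rho>) \<eta> = c ^ N * W (word_of N \<eta>)" if \<eta>: "\<eta> \<in> configs {1..N}" for \<eta>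
  proof -
    have "pmf (Ber {1..N} \<rho>) \<eta> = (\<Prod>x\<in>{1..N}. pmf (bernoulli_pmf \<rho>) (\<eta> x))"
      unfolding Ber_def using \<eta> by (subst pmf_Pi) (auto simp: configs_def PiE_dflt_def)
    also have "\<dots> = (\<Prod>x\<in>{1..N}. c * (if \<eta> x then 1 / \<beta> else 1 / \<alpha>))"
      using \<rho> \<alpha> \<beta> by (intro prod.cong) (auto simp: c_def \<rho>_def)
    also have "\<dots> = c ^ N * (\<Prod>x\<in>{1..N}. if \<eta> x then 1 / \<beta> else 1 / \<alpha>)"
      by (simp add: prod.distrib)
    also have "(\<Prod>x\<in>{1..N}. if \<eta> x then 1 / \<beta> else 1 / \<alpha>) = W (word_of N \<eta>)"
      unfolding W_def word_of_def map_map comp_def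
      using prod.distinct_set_conv_list[of "[1..<Suc N]" "\<lambda>x. if \<eta> x then 1 / \<beta> else 1 / \<alpha>"]
      by (simp add: atLeastLessThanSuc_atLeastAtMost del: upt_Suc)
    finally show ?thesis .
  qed
  then have "(\<Sum>\<eta>\<in>configs {1..N}. pmf (Ber {1..N} \<rho>) \<eta> * asep_generator N q \<alpha> \<beta> f \<eta>) = 0" for f
    using eq0[of f] by (simp add: mult.assoc flip: sum_distrib_left)
  moreover have "set_pmf (Ber {1..N} \<rho>) \<subseteq> configs {1..N}"
    unfolding Ber_def configs_def using set_Pi_pmf_subset[of "{1..N}" False]
    by (auto simp: PiE_dflt_def)
  ultimately show ?thesis
    unfolding stationary_weight_def \<rho>_def[symmetric] by (auto intro!: sum_pmf_eq_1 finite_configs)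
qed

section \<open>The representation with finitely many shocks\<close>

text \<open>
  Writing \<open>D = (1 + d) / (1 - q)\<close> and \<open>E = (1 + e) / (1 - q)\<close>, the bulk relation is \<open>de - q ed = 1 - q\<close>. It holds
  for \<open>e\<close> diagonal with entries \<open>u q ^ i\<close> and \<open>d\<close> upper bidiagonal with the inverse diagonal and any
  superdiagonal. The first unit row vector is then a left eigenvector of \<open>E\<close> for the eigenvalue
  \<open>(1 + u) / (1 - q) = 1 / \<alpha>\<close>. A right eigenvector of \<open>d\<close> for the eigenvalue \<open>v\<close> is determined by its first
  component, and \<open>u v q ^ k = 1\<close> makes it vanish beyond index \<open>k\<close> and positive up to \<open>k\<close>. Vectors are
  sequences, the index of a component being the number of shocks further to the left.

  The constant superdiagonal \<open>g / (1 - q)\<close> of \<open>D\<close> is left open because its choice amounts to a rescaling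
  of the basis, which is used in the estimates below.
\<close>
locale shock_representation =
  fixes q u v g :: real and k :: nat
  assumes q: "0 < q" "q < 1" and u: "u > 0" and g: "g > 0" and special: "u * v * q ^ k = 1"
begin

definition act :: "bool \<Rightarrow> (nat \<Rightarrow> real) \<Rightarrow> nat \<Rightarrow> real" where
  "act b y i = (if b then (1 + 1 / (u * q ^ i)) * y i + g * y (Suc i) else (1 + u * q ^ i) * y i) / (1 - q)"

definition V :: "nat \<Rightarrow> real" where
  "V i = (\<Prod>j<i. (v - 1 / (u * q ^ j)) / g)"

definition W :: "bool list \<Rightarrow> real" where
  "W xs = foldr act xs V 0"

definition total :: "(nat \<Rightarrow> real) \<Rightarrow> nat \<Rightarrow> real" where
  "total y i = ((2 + u * q ^ i + 1 / (u * q ^ i)) * y i + g * y (Suc i)) / (1 - q)"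

lemma v_eq: "v = 1 / (u * q ^ k)"
  using q u special by (simp add: field_simps)

text \<open>
  The factors \<open>v - 1 / (u * q ^ j)\<close> decrease in \<open>j\<close> and reach \<open>0\<close> at \<open>j = k\<close>.
\<close>
lemma V_pos: "i \<le> k \<Longrightarrow> V i > 0"
proof -
  assume i: "i \<le> k"
  have "v - 1 / (u * q ^ j) > 0" if "j < k" for j
  proof -
    have "u * q ^ k < u * q ^ j" using that q u by (simp add: power_strict_decreasing)
    then show ?thesis unfolding v_eq using q u by (simp add: frac_less2)
  qed
  with i g show ?thesis unfolding V_def by (intro prod_pos) auto
qed

lemma V_zero: "i > k \<Longrightarrow> V i = 0"
  unfolding V_def by (simp add: v_eq) blast

lemma V_nonneg: "V i \<ge> 0"
  using V_pos[of i] V_zero[of i] by (cases "i \<le> k") auto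

lemma act_nonneg: "(\<And>i. y i \<ge> 0) \<Longrightarrow> act b y i \<ge> 0"
  unfolding act_def using q u g by (auto intro!: divide_nonneg_pos add_nonneg_nonneg mult_nonneg_nonneg)

lemma foldr_act_nonneg: "(\<And>i. y i \<ge> 0) \<Longrightarrow> foldr act xs y i \<ge> 0"
  by (induction xs arbitrary: i) (auto intro: act_nonneg)

lemma act_linear: "act b (\<lambda>i. c * y i + d * z i) = (\<lambda>i. c * act b y i + d * act b z i)"
  by (auto simp: act_def algebra_simps add_divide_distrib diff_divide_distrib fun_eq_iff)

lemma foldr_act_linear:
  "foldr act xs (\<lambda>i. c * y i + d * z i) = (\<lambda>i. c * foldr act xs y i + d * foldr act xs z i)"
  by (induction xs) (auto simp: act_linear)

lemma act_quadratic:
  "act True (act False y) i - q * act False (act True y) i = act True y i + act False y i"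
proof -
  define s a b where "s = 1 / (1 - q)" and "a = u * q ^ i" and "b = 1 / a"
  have s: "s * (1 - q) = 1" and ab: "a * b = 1"
    using q u by (simp_all add: s_def a_def b_def)
  have D: "act True z i = ((1 + b) * z i + g * z (Suc i)) * s"
    and E: "act False z i = (1 + a) * z i * s" "act False z (Suc i) = (1 + a * q) * z (Suc i) * s" for z
    by (simp_all add: act_def s_def a_def b_def mult_ac)
  show ?thesis unfolding D E using s ab by algebra
qed

lemma act_V: "act True V = (\<lambda>i. (v + 1) / (1 - q) * V i)"
  using g by (auto simp: act_def V_def field_simps fun_eq_iff)

lemma W_ansatz: "word_ansatz q ((1 - q) / (u + 1)) ((1 - q) / (v + 1)) W"
  unfolding word_ansatz_def
proof (intro conjI allI)
  fix pre suf
  let ?y = "foldr act suf V"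
  have "(\<lambda>i. 1 * act True (act False ?y) i + (- q) * act False (act True ?y) i)
      = (\<lambda>i. 1 * act True ?y i + 1 * act False ?y i)"
    using act_quadratic[of ?y] by (simp add: fun_eq_iff)
  then have "foldr act pre (\<lambda>i. 1 * act True (act False ?y) i + (- q) * act False (act True ?y) i) 0
      = foldr act pre (\<lambda>i. 1 * act True ?y i + 1 * act False ?y i) 0" by (rule arg_cong)
  then show "W (pre @ [True, False] @ suf) - q * W (pre @ [False, True] @ suf)
      = W (pre @ [True] @ suf) + W (pre @ [False] @ suf)"
    unfolding foldr_act_linear by (simp add: W_def)
next
  fix suf show "(1 - q) / (u + 1) * W (False # suf) = W suf"
    using q u by (simp add: W_def act_def add.commute[of 1 u])
next
  fix pre
  have v: "v > 0" using q u by (simp add: v_eq)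
  have "act True V = (\<lambda>i. (v + 1) / (1 - q) * V i + 0 * V i)" using act_V by simp
  then have "W (pre @ [True]) = (v + 1) / (1 - q) * W pre"
    by (simp only: W_def foldr_append foldr.simps comp_def id_apply foldr_act_linear)
  then show "(1 - q) / (v + 1) * W (pre @ [True]) = W pre"
    using q v by (simp add: field_simps)
qed

lemma total_eq: "total y i = act True y i + act False y i"
  unfolding total_def act_def by (simp add: add_divide_distrib[symmetric]) (simp add: algebra_simps)

lemma act_sum: "act b (\<lambda>i. \<Sum>x\<in>A. h x i) = (\<lambda>i. \<Sum>x\<in>A. act b (h x) i)"
  by (auto simp: act_def sum_distrib_left sum_divide_distrib sum.distrib fun_eq_iff add_divide_distrib)

lemma sum_words_act: "(\<Sum>xs\<in>words n. foldr act xs y i) = (total ^^ n) y i"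
proof (induction n arbitrary: i)
  case (Suc n)
  then have IH: "(total ^^ n) y = (\<lambda>i. \<Sum>xs\<in>words n. foldr act xs y i)" by auto
  have "(total ^^ Suc n) y i = act True ((total ^^ n) y) i + act False ((total ^^ n) y) i"
    by (simp add: total_eq[of "(total ^^ n) y"])
  then show ?case
    unfolding IH act_sum by (simp add: sum_words_Suc sum.distrib)
qed (simp add: words_0)

lemma sum_words_act_occupied:
  assumes "j < n"
  shows "(\<Sum>xs\<in>words n. of_bool (xs ! j) * foldr act xs y i)
    = (total ^^ j) (act True ((total ^^ (n - 1 - j)) y)) i"
  using assms
proof (induction j arbitrary: n i)
  case 0
  then obtain m where n: "n = Suc m" by (cases n) auto
  have tot: "(total ^^ m) y = (\<lambda>i. \<Sum>xs\<in>words m. foldr act xs y i)" by (simp add: sum_words_act)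
  show ?case by (simp add: n sum_words_Suc tot act_sum)
next
  case (Suc j)
  then obtain m where n: "n = Suc m" "j < m" by (cases n) auto
  have scale: "c * act b z i = act b (\<lambda>i. c * z i) i" for c b z i
    using act_linear[of b c z 0 z] by simp
  have IH: "(total ^^ j) (act True ((total ^^ (m - 1 - j)) y))
      = (\<lambda>i. \<Sum>xs\<in>words m. of_bool (xs ! j) * foldr act xs y i)"
    using Suc.IH[OF n(2)] by auto
  let ?Y = "act True ((total ^^ (m - 1 - j)) y)"
  have "(total ^^ Suc j) ?Y i = act True ((total ^^ j) ?Y) i + act False ((total ^^ j) ?Y) i"
    by (simp only: funpow.simps o_apply total_eq[of "(total ^^ j) ?Y"])
  also have "\<dots> = (\<Sum>xs\<in>words (Suc m). of_bool (xs ! Suc j) * foldr act xs y i)"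
    unfolding IH act_sum by (simp add: sum_words_Suc sum.distrib scale)
  finally show ?case using n by simp
qed

lemma total_linear: "total (\<lambda>i. c * y i + d * z i) = (\<lambda>i. c * total y i + d * total z i)"
  by (auto simp: total_def algebra_simps add_divide_distrib fun_eq_iff)

lemma total_power_linear:
  "(total ^^ n) (\<lambda>i. c * y i + d * z i) = (\<lambda>i. c * (total ^^ n) y i + d * (total ^^ n) z i)"
  by (induction n) (auto simp: total_linear)

lemma total_power_nonneg: "(\<And>i. y i \<ge> 0) \<Longrightarrow> (total ^^ n) y i \<ge> 0"
  by (metis sum_words_act foldr_act_nonneg sum_nonneg)

lemma total_power_zero: "(\<And>i. i > k \<Longrightarrow> y i = 0) \<Longrightarrow> i > k \<Longrightarrow> (total ^^ n) y i = 0"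
  by (induction n arbitrary: i) (auto simp: total_def)

definition eigenvalue :: "nat \<Rightarrow> real" where
  "eigenvalue i = (2 + u * q ^ i + 1 / (u * q ^ i)) / (1 - q)"

end

section \<open>Concentration of the shocks at the right boundary\<close>

text \<open>
  The row of \<open>D + E\<close> with index \<open>i \<ge> 1\<close> has the sum \<open>eigenvalue i + g / (1 - q)\<close>. When \<open>\<kappa>\<close> is at least the
  midpoint of \<open>eigenvalue 0\<close> and every eigenvalue of index \<open>1\<close> to \<open>k\<close>, the choice
  \<open>g / (1 - q) = eigenvalue 0 - \<kappa>\<close> makes these sums at most \<open>\<kappa>\<close> for \<open>i \<le> k\<close>. On vectors supported on
  \<open>{0..k}\<close> all components except the first then grow at most like \<open>\<kappa> ^ n\<close>.
\<close>
locale shock_representation_gap = shock_representation +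
  fixes \<kappa> :: real
  assumes g_eq: "g = (1 - q) * (eigenvalue 0 - \<kappa>)"
    and gap: "\<And>i. 1 \<le> i \<Longrightarrow> i \<le> k \<Longrightarrow> eigenvalue i \<le> 2 * \<kappa> - eigenvalue 0" and \<kappa>: "0 < \<kappa>"
begin

lemma kappa_less_top: "\<kappa> < eigenvalue 0"
  using g q unfolding g_eq by (simp add: zero_less_mult_iff)

lemma coupling_over: "g / (1 - q) = eigenvalue 0 - \<kappa>"
  using q g_eq by simp

lemma total_eq_eigenvalue: "total y i = eigenvalue i * y i + (eigenvalue 0 - \<kappa>) * y (Suc i)"
  by (simp only: coupling_over[symmetric] total_def eigenvalue_def[of i] times_divide_eq_left
      add_divide_distrib[where a = "_ * y i"])

text \<open>
  The first component obeys \<open>a (n + 1) \<le> eigenvalue 0 * a n + (eigenvalue 0 - \<kappa>) * M * \<kappa> ^ n\<close>, and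
  \<open>M * (2 * eigenvalue 0 ^ n - \<kappa> ^ n)\<close> is the solution of the equality that starts at \<open>M\<close>.
\<close>
lemma total_power_bounds:
  assumes zero: "\<And>i. i > k \<Longrightarrow> y i = 0" and bound: "\<And>i. i \<le> k \<Longrightarrow> y i \<le> M" and M: "M \<ge> 0"
  shows "(total ^^ n) y 0 \<le> M * (2 * eigenvalue 0 ^ n - \<kappa> ^ n) \<and> (\<forall>i\<ge>1. (total ^^ n) y i \<le> M * \<kappa> ^ n)"
proof (induction n)
  case 0
  have "y i \<le> M" for i using zero[of i] bound[of i] M by (cases "i \<le> k") auto
  then show ?case by simp
next
  case (Suc n)
  let ?y = "(total ^^ n) y"
  have pos: "eigenvalue 0 - \<kappa> > 0" "eigenvalue i > 0" for i
    using kappa_less_top q u by (auto simp: eigenvalue_def intro!: divide_pos_pos add_pos_pos)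
  have "total ?y 0 \<le> eigenvalue 0 * (M * (2 * eigenvalue 0 ^ n - \<kappa> ^ n)) + (eigenvalue 0 - \<kappa>) * (M * \<kappa> ^ n)"
    unfolding total_eq_eigenvalue[of ?y] using Suc pos(1) pos(2)[of 0] by (intro add_mono mult_left_mono) auto
  also have "\<dots> = M * (2 * eigenvalue 0 ^ Suc n - \<kappa> ^ Suc n)" by (simp add: algebra_simps)
  finally have 0: "total ?y 0 \<le> M * (2 * eigenvalue 0 ^ Suc n - \<kappa> ^ Suc n)" .
  have "total ?y i \<le> M * \<kappa> ^ Suc n" if i: "i \<ge> 1" for i
  proof (cases "i \<le> k")
    case True
    have "total ?y i \<le> eigenvalue i * (M * \<kappa> ^ n) + (eigenvalue 0 - \<kappa>) * (M * \<kappa> ^ n)"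
      unfolding total_eq_eigenvalue[of ?y] using Suc pos(1) pos(2)[of i] i by (intro add_mono mult_left_mono) auto
    also have "\<dots> = (eigenvalue i + (eigenvalue 0 - \<kappa>)) * (M * \<kappa> ^ n)" by (simp add: algebra_simps)
    also have "\<dots> \<le> \<kappa> * (M * \<kappa> ^ n)"
      using gap[OF i True] M \<kappa> by (intro mult_right_mono) auto
    finally show ?thesis by (simp add: mult_ac)
  next
    case False
    then have "(total ^^ Suc n) y i = 0" by (intro total_power_zero zero) auto
    then show ?thesis using M \<kappa> by simp
  qed
  with 0 show ?case by simp
qed

definition "V_sum = (\<Sum>i\<le>k. V i)"

lemma V_le: "i \<le> k \<Longrightarrow> V i \<le> V_sum"
  unfolding V_sum_def using V_nonneg by (intro member_le_sum) auto

lemma V_sum_nonneg: "V_sum \<ge> 0"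
  unfolding V_sum_def using V_nonneg by (intro sum_nonneg) auto

lemma partition_lower: "(\<Sum>xs\<in>words n. W xs) \<ge> eigenvalue 0 ^ n"
proof -
  have "(total ^^ n) V 0 \<ge> eigenvalue 0 ^ n"
  proof (induction n)
    case (Suc n)
    have "eigenvalue 0 * eigenvalue 0 ^ n + 0 \<le> eigenvalue 0 * (total ^^ n) V 0 + (eigenvalue 0 - \<kappa>) * (total ^^ n) V (Suc 0)"
      using Suc kappa_less_top \<kappa> total_power_nonneg[of V n, OF V_nonneg]
      by (intro add_mono mult_left_mono mult_nonneg_nonneg) auto
    then show ?case by (simp add: total_eq_eigenvalue[of "(total ^^ n) V"])
  qed (simp add: V_def)
  then show ?thesis by (simp add: W_def sum_words_act)
qed

text \<open>
  The excess of the density over \<open>\<rho> = 1 / (1 + u)\<close> is obtained by placing the matrix \<open>D - \<rho> (D + E)\<close> at the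
  given site. Its corner entry vanishes, since \<open>\<rho>\<close> is the quotient of the corner entries of \<open>D\<close> and \<open>D + E\<close>.
  Thus only paths that have left the corner by the next site contribute, and to the right of it they
  collect at most a power of \<open>\<kappa>\<close>, whereas the partition function is at least a power of \<open>eigenvalue 0\<close>.
\<close>
lemma density_bound:
  assumes j: "j < n"
  shows "(\<Sum>xs\<in>words n. of_bool (xs ! j) * W xs) / (\<Sum>xs\<in>words n. W xs)
    \<le> 1 / (1 + u) + 2 * V_sum * (\<kappa> / eigenvalue 0) ^ (n - 1 - j)"
proof -
  define m where "m = n - 1 - j"
  have n: "n = j + Suc m" using j by (simp add: m_def)
  define \<rho> where "\<rho> = 1 / (1 + u)"
  have \<rho>: "0 < \<rho>" "\<rho> < 1" using u by (auto simp: \<rho>_def)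
  let ?Z = "\<Sum>xs\<in>words n. W xs"
  let ?y = "(total ^^ m) V"
  define z where "z = (\<lambda>i. 1 * act True ?y i + (- \<rho>) * total ?y i)"
  have eigenvalue0: "eigenvalue 0 > 0" using \<kappa> kappa_less_top by linarith
  have y_nonneg: "?y i \<ge> 0" for i by (intro total_power_nonneg V_nonneg)
  have y_le: "?y i \<le> V_sum * \<kappa> ^ m" if "i \<ge> 1" for i
    using total_power_bounds[of V V_sum m] V_zero V_le V_sum_nonneg that by auto
  have y_zero: "?y i = 0" if "i > k" for i by (intro total_power_zero V_zero that)
  have "(total ^^ j) z 0 = (total ^^ j) (act True ?y) 0 - \<rho> * (total ^^ j) (total ?y) 0"
    unfolding z_def total_power_linear by simp
  also have "(total ^^ j) (total ?y) = (total ^^ n) V"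
    unfolding n funpow_add by simp
  also have "(total ^^ j) (act True ?y) 0 = (\<Sum>xs\<in>words n. of_bool (xs ! j) * W xs)"
    unfolding W_def by (subst sum_words_act_occupied[OF j]) (simp add: m_def)
  also have "(total ^^ n) V 0 = ?Z" by (simp add: W_def sum_words_act)
  finally have excess: "(\<Sum>xs\<in>words n. of_bool (xs ! j) * W xs) = \<rho> * ?Z + (total ^^ j) z 0" by simp
  let ?M = "V_sum * eigenvalue 0 * \<kappa> ^ m"
  have M: "?M \<ge> 0" using V_sum_nonneg eigenvalue0 \<kappa> by simp
  have z_le: "z i \<le> ?M" for i
  proof (cases "i = 0")
    case True
    have "act True ?y 0 = \<rho> * (eigenvalue 0 * ?y 0) + (eigenvalue 0 - \<kappa>) * ?y 1"
    proof -
      have "2 + u + 1 / u = (1 + u) * (1 + 1 / u)"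
        using u by (simp add: field_simps)
      then have "1 + 1 / u = \<rho> * (2 + u + 1 / u)"
        using u by (simp add: \<rho>_def)
      then have "(1 + 1 / u) / (1 - q) = \<rho> * eigenvalue 0" by (simp add: eigenvalue_def)
      moreover have "act True ?y 0 = (1 + 1 / u) / (1 - q) * ?y 0 + g / (1 - q) * ?y 1"
        unfolding act_def by (simp add: add_divide_distrib[where b = "g * _"])
      ultimately show ?thesis by (simp add: coupling_over)
    qed
    \<comment> \<open>the corner entry of \<open>D - \<rho> (D + E)\<close> has cancelled\<close>
    then have "z 0 = (1 - \<rho>) * (eigenvalue 0 - \<kappa>) * ?y 1"
      by (simp add: z_def total_eq_eigenvalue[of ?y] algebra_simps)
    also have "\<dots> \<le> (1 * eigenvalue 0) * (V_sum * \<kappa> ^ m)"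
      using \<rho> kappa_less_top \<kappa> eigenvalue0 y_le[of 1] y_nonneg[of 1] by (intro mult_mono) auto
    finally show ?thesis using True by (simp add: mult_ac)
  next
    case False
    have "z i \<le> act True ?y i"
      using \<rho> total_power_nonneg[of V "Suc m" i, OF V_nonneg] by (simp add: z_def)
    also have "\<dots> \<le> total ?y i"
      unfolding total_eq[of ?y] using act_nonneg[of ?y False i, OF y_nonneg] by linarith
    also have "\<dots> \<le> V_sum * \<kappa> ^ Suc m"
      using total_power_bounds[of V V_sum "Suc m"] V_zero V_le V_sum_nonneg False by auto
    also have "\<dots> = V_sum * \<kappa> * \<kappa> ^ m" by simp
    also have "\<dots> \<le> ?M"
      using V_sum_nonneg kappa_less_top \<kappa> by (intro mult_right_mono mult_left_mono) auto
    finally show ?thesis .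
  qed
  have z_zero: "z i = 0" if "i > k" for i
    using y_zero[OF that] y_zero[of "Suc i"] that by (simp add: z_def total_def act_def)
  have "(total ^^ j) z 0 \<le> ?M * (2 * eigenvalue 0 ^ j - \<kappa> ^ j)"
    using total_power_bounds[of z ?M j] z_zero z_le M by auto
  also have "\<dots> \<le> ?M * (2 * eigenvalue 0 ^ j)" using M \<kappa> by (intro mult_left_mono) auto
  also have "\<dots> = 2 * V_sum * (\<kappa> / eigenvalue 0) ^ m * eigenvalue 0 ^ n"
    using eigenvalue0 by (simp add: n power_add power_divide)
  also have "\<dots> \<le> 2 * V_sum * (\<kappa> / eigenvalue 0) ^ m * ?Z"
    using partition_lower V_sum_nonneg \<kappa> eigenvalue0 by (intro mult_left_mono) auto
  finally have "(\<Sum>xs\<in>words n. of_bool (xs ! j) * W xs) \<le> (\<rho> + 2 * V_sum * (\<kappa> / eigenvalue 0) ^ m) * ?Z"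
    unfolding excess by (simp add: algebra_simps)
  moreover have "?Z > 0" using partition_lower[of n] eigenvalue0 by (meson less_le_trans zero_less_power)
  ultimately show ?thesis by (simp add: \<rho>_def m_def divide_le_eq)
qed

end

text \<open>
  The eigenvalues are increasing functions of \<open>t + 1 / t\<close> at \<open>t = u q ^ i\<close>. For \<open>1 \<le> i \<le> k\<close> the number \<open>t\<close>
  lies strictly between \<open>1 / u\<close> and \<open>u\<close>, because \<open>u q ^ k = 1 / v > 1 / u\<close>. So \<open>i = 0\<close> gives the strict
  maximum.
\<close>
lemma exists_shock_words:
  assumes q: "0 < q" "q < 1" and u: "u > 1" "u > v" and v: "v > 0"
    and k: "k \<ge> 1" and special: "u * v * q ^ k = 1"
  shows "\<exists>W K r. word_ansatz q ((1 - q) / (u + 1)) ((1 - q) / (v + 1)) W \<and>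
      (\<forall>xs. 0 \<le> W xs) \<and> (\<forall>n. 0 < (\<Sum>xs\<in>words n. W xs)) \<and> 0 \<le> K \<and> 0 < r \<and> r < 1 \<and>
      (\<forall>n j. j < n \<longrightarrow> (\<Sum>xs\<in>words n. of_bool (xs ! j) * W xs) / (\<Sum>xs\<in>words n. W xs)
         \<le> 1 / (1 + u) + K * r ^ (n - 1 - j))"
proof -
  define e where "e i = (2 + u * q ^ i + 1 / (u * q ^ i)) / (1 - q)" for i
  have e_less: "e i < e 0" if i: "i \<in> {1..k}" for i
  proof -
    define t where "t = u * q ^ i"
    have t: "t > 0" "t < u"
      using i u q by (auto simp: t_def power_less_one_iff)
    have "q ^ k \<le> q ^ i" using i q by (intro power_decreasing) auto
    then have "u * v * q ^ k \<le> v * t"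
      using u v by (simp add: t_def mult_ac)
    also have "v * t < u * t" using t u by simp
    finally have "1 < u * t" unfolding special .
    have "u + 1 / u - (t + 1 / t) = (u - t) * (1 - 1 / (u * t))"
      using t u by (simp add: field_simps)
    also have "\<dots> > 0" using t \<open>1 < u * t\<close> by (intro mult_pos_pos) auto
    finally have "t + 1 / t < u + 1 / u" by simp
    then show ?thesis using q unfolding e_def t_def[symmetric] by (simp add: divide_strict_right_mono)
  qed
  define m where "m = Max (e ` {1..k})"
  have m: "m < e 0" "\<And>i. i \<in> {1..k} \<Longrightarrow> e i \<le> m"
    unfolding m_def using k e_less by (auto intro!: Max_ge)
  have "e 1 > 0" unfolding e_def using q u by (auto intro!: divide_pos_pos add_pos_pos)
  then have m0: "m > 0" using m(2)[of 1] k by simp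
  \<comment> \<open>the smallest value that satisfies the gap condition\<close>
  define \<kappa> where "\<kappa> = (m + e 0) / 2"
  define g where "g = (1 - q) * (e 0 - \<kappa>)"
  have \<kappa>: "0 < \<kappa>" "\<kappa> < e 0" "m = 2 * \<kappa> - e 0" using m m0 by (auto simp: \<kappa>_def field_simps)
  have g: "g > 0" unfolding g_def using q \<kappa> by (intro mult_pos_pos) auto
  interpret shock_representation q u v g k
    by unfold_locales (use q u g special in auto)
  have eigenvalue: "eigenvalue = e" by (auto simp: eigenvalue_def e_def)
  interpret shock_representation_gap q u v g k \<kappa>
    by unfold_locales (use m \<kappa> in \<open>auto simp: eigenvalue g_def\<close>)
  have eigenvalue0: "eigenvalue 0 > 0" using \<kappa> kappa_less_top by linarith
  show ?thesis
  proof (intro exI conjI allI impI)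
    show "0 < (\<Sum>xs\<in>words n. W xs)" for n
      using partition_lower[of n] eigenvalue0 by (meson less_le_trans zero_less_power)
    show "0 \<le> W xs" for xs
      unfolding W_def by (intro foldr_act_nonneg V_nonneg)
    show "0 < \<kappa> / eigenvalue 0" "\<kappa> / eigenvalue 0 < 1"
      using \<kappa> kappa_less_top eigenvalue0 by simp_all
    show "(\<Sum>xs\<in>words n. of_bool (xs ! j) * W xs) / (\<Sum>xs\<in>words n. W xs)
        \<le> 1 / (1 + u) + 2 * V_sum * (\<kappa> / eigenvalue 0) ^ (n - 1 - j)" if "j < n" for n j
      by (rule density_bound[OF that])
  qed (use W_ansatz V_sum_nonneg in simp_all)
qed

section \<open>Bounds for finite systems\<close>

lemma marginal_Ber: "finite J \<Longrightarrow> I \<subseteq> J \<Longrightarrow> marginal I (Ber J \<rho>) = Ber I \<rho>"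
  unfolding marginal_def Ber_def by (rule Pi_pmf_subset[symmetric])

lemma Ber_support: "finite J \<Longrightarrow> set_pmf (Ber J \<rho>) \<subseteq> configs J"
  unfolding Ber_def configs_def using set_Pi_pmf_subset[of J False] by (auto simp: PiE_dflt_def)

lemma Ber_density:
  assumes J: "finite J" "x \<in> J" and \<rho>: "0 \<le> \<rho>" "\<rho> \<le> 1"
  shows "(\<Sum>\<eta>\<in>configs J. pmf (Ber J \<rho>) \<eta> * of_bool (\<eta> x)) = \<rho>"
proof -
  have "(\<Sum>\<eta>\<in>configs J. pmf (Ber J \<rho>) \<eta> * of_bool (\<eta> x))
      = measure_pmf.expectation (Ber J \<rho>) (\<lambda>\<eta>. of_bool (\<eta> x))"
    using Ber_support[OF J(1)] J(1)
    by (subst integral_measure_pmf_real[where A = "configs J"]) (auto simp: finite_configs mult.commute)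
  also have "\<dots> = measure_pmf.expectation (map_pmf (\<lambda>\<eta>. \<eta> x) (Ber J \<rho>)) of_bool"
    by simp
  also have "map_pmf (\<lambda>\<eta>. \<eta> x) (Ber J \<rho>) = bernoulli_pmf \<rho>"
    unfolding Ber_def using J by (simp add: Pi_pmf_component)
  finally show ?thesis using \<rho> by simp
qed

lemma density_of_words:
  assumes "x \<in> {1..N}"
  shows "(\<Sum>\<eta>\<in>configs {1..N}. W (word_of N \<eta>) / Z * of_bool (\<eta> x))
    = (\<Sum>xs\<in>words N. of_bool (xs ! (x - 1)) * W xs) / (Z :: real)"
  using sum_configs_words[of "\<lambda>xs. of_bool (xs ! (x - 1)) * W xs" N] word_of_nth[OF assms]
  by (simp add: mult.commute flip: sum_divide_distrib)

lemma sum_powers_le: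
  fixes r :: real
  assumes "finite S" "inj_on j S" "0 < r" "r < 1"
  shows "(\<Sum>x\<in>S. r ^ j x) \<le> 1 / (1 - r)"
proof -
  have "(\<Sum>x\<in>S. r ^ j x) = (\<Sum>i\<in>j ` S. r ^ i)"
    using assms by (simp add: sum.reindex)
  also have "\<dots> \<le> (\<Sum>i. r ^ i)"
    using assms by (intro sum_le_suminf summable_geometric) auto
  also have "\<dots> = 1 / (1 - r)" using assms by (intro suminf_geometric) auto
  finally show ?thesis .
qed

lemma stationary_support: "asep_stationary N q \<alpha> \<beta> \<mu> \<Longrightarrow> set_pmf \<mu> \<subseteq> configs {1..N}"
  by (simp add: asep_stationary_def)

lemma mono_site: "mono (\<lambda>\<eta>. of_bool (\<eta> x) :: real)"
  by (auto simp: mono_def le_fun_def)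

text \<open>
  The measure \<open>\<mu>\<close> lies between the Bernoulli measure, which is stationary for the exit rate
  \<open>1 - q - \<alpha> > \<beta>\<close>, and the shock measure for the exit rate \<open>\<beta>' \<le> \<beta>\<close>. The distance is measured to the lower
  of the two, the density of \<open>\<mu>\<close> is bounded by that of the upper.
\<close>
lemma low_density_bound:
  fixes q \<alpha> \<beta> \<beta>' :: real
  defines "u \<equiv> boundary_param q \<alpha>" and "v' \<equiv> boundary_param q \<beta>'"
  assumes q: "0 \<le> q" "q < 1" and \<alpha>: "\<alpha> > 0" and \<beta>: "0 < \<beta>'" "\<beta>' \<le> \<beta>" and shock: "\<alpha> + \<beta> < 1 - q"
    and u: "u > 1" "u > v'" and k: "k \<ge> 1" and special: "u * v' * q ^ k = 1"
  obtains K r where "0 < r" "r < 1"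
    "\<And>N a b \<mu>. N \<ge> 1 \<Longrightarrow> 1 \<le> a \<Longrightarrow> b \<le> N \<Longrightarrow> asep_stationary N q \<alpha> \<beta> \<mu> \<Longrightarrow>
       tv_dist {a..b} (marginal {a..b} \<mu>) (Ber {a..b} (\<alpha> / (1 - q))) \<le> K * r ^ (N - b)"
proof -
  have "q \<noteq> 0"
  proof
    assume "q = 0"
    then have "q ^ k = 0" using k by simp
    with special show False by simp
  qed
  with q have q0: "q > 0" by simp
  have v': "v' > 0"
  proof (rule ccontr)
    assume "\<not> v' > 0"
    then have "u * v' * q ^ k \<le> 0" using u q0 by (simp add: mult_nonneg_nonpos mult_nonpos_nonneg)
    then show False using special by simp
  qed
  have params: "(1 - q) / (u + 1) = \<alpha>" "(1 - q) / (v' + 1) = \<beta>'" "1 / (1 + u) = \<alpha> / (1 - q)"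
    using q \<alpha> \<beta> by (auto simp: u_def v'_def boundary_param_def)
  obtain W K r where W: "word_ansatz q \<alpha> \<beta>' W" "\<And>xs. 0 \<le> W xs" "\<And>n. 0 < (\<Sum>xs\<in>words n. W xs)"
    and Kr: "0 \<le> K" "0 < r" "r < 1"
    and dens: "\<And>n j. j < n \<Longrightarrow> (\<Sum>xs\<in>words n. of_bool (xs ! j) * W xs) / (\<Sum>xs\<in>words n. W xs)
       \<le> \<alpha> / (1 - q) + K * r ^ (n - 1 - j)"
    using exists_shock_words[OF q0 q(2) u v' k special, unfolded params] by blast
  define \<rho> where "\<rho> = \<alpha> / (1 - q)"
  have \<rho>: "0 \<le> \<rho>" "\<rho> \<le> 1" using \<alpha> \<beta> shock q by (auto simp: \<rho>_def field_simps)
  show thesis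
  proof (rule that[of r "K / (1 - r)"])
    fix N a b :: nat and \<mu> assume N: "N \<ge> 1" and ab: "1 \<le> a" "b \<le> N" and \<mu>: "asep_stationary N q \<alpha> \<beta> \<mu>"
    let ?I = "{a..b}" and ?J = "{1..N}"
    let ?w = "\<lambda>\<eta>. W (word_of N \<eta>) / (\<Sum>xs\<in>words N. W xs)"
    have st: "stationary_weight N q \<alpha> \<beta> (pmf \<mu>)" by (rule stationary_weight_pmf[OF N \<mu>])
    have IJ: "?I \<subseteq> ?J" using ab by auto
    have stBer: "stationary_weight N q \<alpha> (1 - q - \<alpha>) (pmf (Ber ?J \<rho>))"
      unfolding \<rho>_def using \<alpha> \<beta> shock N by (intro Ber_stationary) auto
    have "stationary_weight N q \<alpha> \<beta>' ?w"
      by (intro stationary_weight_of_words N W)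
    then have upper: "(\<Sum>\<eta>\<in>configs ?J. pmf \<mu> \<eta> * f \<eta>) \<le> (\<Sum>\<eta>\<in>configs ?J. ?w \<eta> * f \<eta>)"
      if "mono f" for f :: "_ \<Rightarrow> real"
      using st \<alpha> \<beta> q N that by (intro stationary_comparison[of N q \<alpha> \<alpha> \<beta>' \<beta>]) auto
    have lower: "(\<Sum>\<eta>\<in>configs ?J. pmf (Ber ?J \<rho>) \<eta> * f \<eta>) \<le> (\<Sum>\<eta>\<in>configs ?J. pmf \<mu> \<eta> * f \<eta>)"
      if "mono f" for f :: "_ \<Rightarrow> real"
      using st stBer \<alpha> \<beta> q N shock that
      by (intro stationary_comparison[of N q \<alpha> \<alpha> \<beta> "1 - q - \<alpha>"]) auto
    have "tv_dist ?I (marginal ?I \<mu>) (marginal ?I (Ber ?J \<rho>))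
      \<le> (\<Sum>x\<in>?I. (\<Sum>\<eta>\<in>configs ?J. pmf \<mu> \<eta> * of_bool (\<eta> x))
            - (\<Sum>\<eta>\<in>configs ?J. pmf (Ber ?J \<rho>) \<eta> * of_bool (\<eta> x)))"
      by (intro tv_dist_marginal_le_density IJ lower Ber_support stationary_support[OF \<mu>]) auto
    also have "\<dots> \<le> (\<Sum>x\<in>?I. K * r ^ (N - b) * r ^ (b - x))"
    proof (rule sum_mono)
      fix x assume x: "x \<in> ?I"
      then have xJ: "x \<in> ?J" and j: "x - 1 < N" using IJ by auto
      have "(\<Sum>\<eta>\<in>configs ?J. pmf \<mu> \<eta> * of_bool (\<eta> x)) \<le> \<rho> + K * r ^ (N - 1 - (x - 1))"
        using upper[OF mono_site, of x] dens[OF j] unfolding density_of_words[OF xJ] \<rho>_def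
        by linarith
      moreover have "N - 1 - (x - 1) = (N - b) + (b - x)" using x ab by auto
      ultimately show "(\<Sum>\<eta>\<in>configs ?J. pmf \<mu> \<eta> * of_bool (\<eta> x))
            - (\<Sum>\<eta>\<in>configs ?J. pmf (Ber ?J \<rho>) \<eta> * of_bool (\<eta> x)) \<le> K * r ^ (N - b) * r ^ (b - x)"
        using Ber_density[of ?J x \<rho>] xJ \<rho> by (simp add: power_add mult.assoc)
    qed
    also have "\<dots> = K * r ^ (N - b) * (\<Sum>x\<in>?I. r ^ (b - x))" by (simp add: sum_distrib_left)
    also have "\<dots> \<le> K * r ^ (N - b) * (1 / (1 - r))"
      using Kr by (intro mult_left_mono sum_powers_le) (auto simp: inj_on_def)
    finally show "tv_dist ?I (marginal ?I \<mu>) (Ber ?I (\<alpha> / (1 - q))) \<le> K / (1 - r) * r ^ (N - b)"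
      using marginal_Ber[OF _ IJ] by (simp add: \<rho>_def mult_ac)
  qed (use Kr in auto)
qed

text \<open>
  The shock measure for the entry rate \<open>\<alpha>' \<le> \<alpha>\<close>, obtained by reflection, now lies below \<open>\<mu>\<close>, and the
  Bernoulli measure, stationary for the entry rate \<open>1 - q - \<beta> > \<alpha>\<close>, above it.
\<close>
lemma high_density_bound:
  fixes q \<alpha> \<beta> \<alpha>' :: real
  defines "v \<equiv> boundary_param q \<beta>" and "u' \<equiv> boundary_param q \<alpha>'"
  assumes q: "0 \<le> q" "q < 1" and \<beta>: "\<beta> > 0" and \<alpha>: "0 < \<alpha>'" "\<alpha>' \<le> \<alpha>" and shock: "\<alpha> + \<beta> < 1 - q"
    and v: "v > 1" "v > u'" and k: "k \<ge> 1" and special: "u' * v * q ^ k = 1"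
  obtains K r where "0 < r" "r < 1"
    "\<And>N a b \<mu>. N \<ge> 1 \<Longrightarrow> 1 \<le> a \<Longrightarrow> b \<le> N \<Longrightarrow> asep_stationary N q \<alpha> \<beta> \<mu> \<Longrightarrow>
       tv_dist {a..b} (marginal {a..b} \<mu>) (Ber {a..b} (1 - \<beta> / (1 - q))) \<le> K * r ^ (a - 1)"
proof -
  have special': "v * u' * q ^ k = 1" using special by (simp add: mult_ac)
  have "q \<noteq> 0"
  proof
    assume "q = 0"
    then have "q ^ k = 0" using k by simp
    with special show False by simp
  qed
  with q have q0: "q > 0" by simp
  have u': "u' > 0"
  proof (rule ccontr)
    assume "\<not> u' > 0"
    then have "v * u' * q ^ k \<le> 0" using v q0 by (simp add: mult_nonneg_nonpos mult_nonpos_nonneg)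
    then show False using special' by simp
  qed
  have params: "(1 - q) / (v + 1) = \<beta>" "(1 - q) / (u' + 1) = \<alpha>'" "1 / (1 + v) = \<beta> / (1 - q)"
    using q \<alpha> \<beta> by (auto simp: v_def u'_def boundary_param_def)
  obtain W K r where W: "word_ansatz q \<beta> \<alpha>' W" "\<And>xs. 0 \<le> W xs" "\<And>n. 0 < (\<Sum>xs\<in>words n. W xs)"
    and Kr: "0 \<le> K" "0 < r" "r < 1"
    and dens: "\<And>n j. j < n \<Longrightarrow> (\<Sum>xs\<in>words n. of_bool (xs ! j) * W xs) / (\<Sum>xs\<in>words n. W xs)
       \<le> \<beta> / (1 - q) + K * r ^ (n - 1 - j)"
    using exists_shock_words[OF q0 q(2) v u' k special', unfolded params] by blast
  define W' where "W' xs = W (rev (map Not xs))" for xs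
  have W': "word_ansatz q \<alpha>' \<beta> W'" "\<And>xs. 0 \<le> W' xs"
    "(\<Sum>xs\<in>words n. W' xs) = (\<Sum>xs\<in>words n. W xs)" for n
    using word_ansatz_reflect[OF W(1)] W(2) sum_words_reflect[of W n] by (auto simp: W'_def[abs_def])
  define \<rho> where "\<rho> = (1 - q - \<beta>) / (1 - q)"
  have \<rho>: "0 \<le> \<rho>" "\<rho> \<le> 1" "\<rho> = 1 - \<beta> / (1 - q)" using \<alpha> \<beta> shock q by (auto simp: \<rho>_def field_simps)
  have dens': "(\<Sum>xs\<in>words n. of_bool (xs ! j) * W' xs) / (\<Sum>xs\<in>words n. W' xs) \<ge> \<rho> - K * r ^ j"
    if j: "j < n" for n j
  proof -
    let ?Z = "\<Sum>xs\<in>words n. W xs" and ?j = "n - 1 - j"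
    \<comment> \<open>site \<open>j\<close> of the reflected word is the complement of site \<open>n - 1 - j\<close>\<close>
    have "(\<Sum>xs\<in>words n. of_bool (xs ! j) * W' xs)
        = (\<Sum>xs\<in>words n. of_bool (\<not> rev (map Not xs) ! ?j) * W (rev (map Not xs)))"
      unfolding W'_def using j by (intro sum.cong) (auto simp: words_def rev_nth)
    also have "\<dots> = (\<Sum>xs\<in>words n. of_bool (\<not> xs ! ?j) * W xs)"
      by (rule sum_words_reflect)
    also have "\<dots> = ?Z - (\<Sum>xs\<in>words n. of_bool (xs ! ?j) * W xs)"
      by (subst sum_subtractf[symmetric], intro sum.cong) auto
    finally have "(\<Sum>xs\<in>words n. of_bool (xs ! j) * W' xs) / ?Z
        = 1 - (\<Sum>xs\<in>words n. of_bool (xs ! ?j) * W xs) / ?Z"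
      using W(3)[of n] by (simp add: diff_divide_distrib)
    moreover have "n - 1 - ?j = j" "?j < n" using j by auto
    ultimately show ?thesis using dens[of ?j n] by (simp add: W'(3) \<rho>(3))
  qed
  show thesis
  proof (rule that[of r "K / (1 - r)"])
    fix N a b :: nat and \<mu> assume N: "N \<ge> 1" and ab: "1 \<le> a" "b \<le> N" and \<mu>: "asep_stationary N q \<alpha> \<beta> \<mu>"
    let ?I = "{a..b}" and ?J = "{1..N}"
    let ?w = "\<lambda>\<eta>. W' (word_of N \<eta>) / (\<Sum>xs\<in>words N. W' xs)"
    have st: "stationary_weight N q \<alpha> \<beta> (pmf \<mu>)" by (rule stationary_weight_pmf[OF N \<mu>])
    have IJ: "?I \<subseteq> ?J" using ab by auto
    have stBer: "stationary_weight N q (1 - q - \<beta>) \<beta> (pmf (Ber ?J \<rho>))"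
      unfolding \<rho>_def using \<alpha> \<beta> shock N by (intro Ber_stationary) auto
    have "stationary_weight N q \<alpha>' \<beta> ?w"
      using W(3) by (intro stationary_weight_of_words N W') (simp add: W'(3))
    then have lower: "(\<Sum>\<eta>\<in>configs ?J. ?w \<eta> * f \<eta>) \<le> (\<Sum>\<eta>\<in>configs ?J. pmf \<mu> \<eta> * f \<eta>)"
      if "mono f" for f :: "_ \<Rightarrow> real"
      using st \<alpha> \<beta> q N that by (intro stationary_comparison[of N q \<alpha>' \<alpha> \<beta> \<beta>]) auto
    have upper: "(\<Sum>\<eta>\<in>configs ?J. pmf \<mu> \<eta> * f \<eta>) \<le> (\<Sum>\<eta>\<in>configs ?J. pmf (Ber ?J \<rho>) \<eta> * f \<eta>)"
      if "mono f" for f :: "_ \<Rightarrow> real"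
      using st stBer \<alpha> \<beta> q N shock that
      by (intro stationary_comparison[of N q \<alpha> "1 - q - \<beta>" \<beta> \<beta>]) auto
    have "tv_dist ?I (marginal ?I (Ber ?J \<rho>)) (marginal ?I \<mu>)
      \<le> (\<Sum>x\<in>?I. (\<Sum>\<eta>\<in>configs ?J. pmf (Ber ?J \<rho>) \<eta> * of_bool (\<eta> x))
            - (\<Sum>\<eta>\<in>configs ?J. pmf \<mu> \<eta> * of_bool (\<eta> x)))"
      by (intro tv_dist_marginal_le_density IJ upper Ber_support stationary_support[OF \<mu>]) auto
    also have "\<dots> \<le> (\<Sum>x\<in>?I. K * r ^ (a - 1) * r ^ (x - a))"
    proof (rule sum_mono)
      fix x assume x: "x \<in> ?I"
      then have xJ: "x \<in> ?J" and j: "x - 1 < N" using IJ by auto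
      have "(\<Sum>\<eta>\<in>configs ?J. pmf \<mu> \<eta> * of_bool (\<eta> x)) \<ge> \<rho> - K * r ^ (x - 1)"
        using lower[OF mono_site, of x] dens'[OF j] unfolding density_of_words[OF xJ]
        by linarith
      moreover have "x - 1 = (a - 1) + (x - a)" using x ab by auto
      ultimately show "(\<Sum>\<eta>\<in>configs ?J. pmf (Ber ?J \<rho>) \<eta> * of_bool (\<eta> x))
            - (\<Sum>\<eta>\<in>configs ?J. pmf \<mu> \<eta> * of_bool (\<eta> x)) \<le> K * r ^ (a - 1) * r ^ (x - a)"
        using Ber_density[of ?J x \<rho>] xJ \<rho> by (simp add: power_add mult.assoc)
    qed
    also have "\<dots> = K * r ^ (a - 1) * (\<Sum>x\<in>?I. r ^ (x - a))" by (simp add: sum_distrib_left)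
    also have "\<dots> \<le> K * r ^ (a - 1) * (1 / (1 - r))"
      using Kr by (intro mult_left_mono sum_powers_le) (auto simp: inj_on_def)
    finally show "tv_dist ?I (marginal ?I \<mu>) (Ber ?I (1 - \<beta> / (1 - q))) \<le> K / (1 - r) * r ^ (a - 1)"
      using marginal_Ber[OF _ IJ] by (simp add: \<rho>(3) tv_dist_sym mult_ac)
  qed (use Kr in auto)
qed

section \<open>The limit of large systems\<close>

lemma tv_dist_nonneg: "tv_dist I \<mu> \<nu> \<ge> 0"
  by (simp add: tv_dist_def sum_nonneg)

lemma tendsto_zero_of_geometric_bound:
  fixes X t :: "nat \<Rightarrow> real"
  assumes r: "0 < r" "r < 1" and X: "X \<ggreater> (\<lambda>_. 1)" and n: "\<And>N. N \<ge> 1 \<Longrightarrow> X N \<le> real (n N) + 1"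
    and t: "\<And>N. N \<ge> 1 \<Longrightarrow> 0 \<le> t N" "\<And>N. N \<ge> 1 \<Longrightarrow> t N \<le> K * r ^ n N"
  shows "t \<longlonglongrightarrow> 0"
proof -
  have "filterlim n at_top sequentially"
    unfolding filterlim_at_top
  proof
    fix Z :: nat
    have "ereal (real Z + 1) < liminf (\<lambda>N. ereal (X N / 1))"
      using X by (simp add: much_greater_def)
    then have "eventually (\<lambda>N. ereal (real Z + 1) < ereal (X N / 1)) sequentially"
      by (rule less_LiminfD)
    then show "eventually (\<lambda>N. Z \<le> n N) sequentially"
      using eventually_ge_at_top[of 1]
    proof eventually_elim
      case (elim N)
      then show ?case using n[of N] by simp
    qed
  qed
  then have "(\<lambda>N. r ^ n N) \<longlonglongrightarrow> 0"
    using r by (intro filterlim_compose[OF LIMSEQ_realpow_zero]) auto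
  then have limit: "(\<lambda>N. K * r ^ n N) \<longlonglongrightarrow> 0" by (intro tendsto_mult_right_zero)
  show ?thesis
    by (rule tendsto_sandwich[OF _ _ tendsto_const limit]; rule eventually_sequentiallyI[of 1]; simp add: t)
qed

text \<open>
  Both sides say that \<open>(1 - q) (1 - q - \<alpha> - \<beta>)\<close> is positive.
\<close>
lemma shock_region_iff:
  assumes "q < 1" "\<alpha> > 0" "\<beta> > 0"
  shows "boundary_param q \<alpha> * boundary_param q \<beta> > 1 \<longleftrightarrow> \<alpha> + \<beta> < 1 - q"
proof -
  define d where "d = (1 - q) / (\<alpha> * \<beta>)"
  have d: "d > 0" using assms by (simp add: d_def)
  have "boundary_param q \<alpha> * boundary_param q \<beta> - 1 = d * (1 - q - (\<alpha> + \<beta>))"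
    using assms by (simp add: boundary_param_def d_def field_simps)
  then have "boundary_param q \<alpha> * boundary_param q \<beta> > 1 \<longleftrightarrow> 0 < d * (1 - q - (\<alpha> + \<beta>))"
    by linarith
  then show ?thesis using d by (simp add: zero_less_mult_iff)
qed

theorem theorem1p4:
  fixes q \<alpha> \<beta> u v :: real and \<mu> :: "nat \<Rightarrow> (nat \<Rightarrow> bool) pmf"
  assumes "0 \<le> q" and "q < 1" and "\<alpha> > 0" and "\<beta> > 0"
    and u: "u = boundary_param q \<alpha>" and v: "v = boundary_param q \<beta>"
    and \<mu>: "\<And>N. N \<ge> 1 \<Longrightarrow> asep_stationary N q \<alpha> \<beta> (\<mu> N)"
  shows
    "(u * v > 1 \<and> u > max 1 v \<and>
      (\<exists>\<beta>'>0. \<exists>\<beta>''>0. \<exists>k\<ge>1.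
         \<beta> \<in> {\<beta>'..\<beta>''} \<and>
         u > Max {boundary_param q \<beta>', boundary_param q \<beta>'', 1} \<and>
         u * boundary_param q \<beta>' * q ^ k = 1 \<and>
         u * boundary_param q \<beta>'' * q ^ (k - 1) = 1)
      \<longrightarrow> (\<forall>a b :: nat \<Rightarrow> nat.
            (\<forall>N\<ge>1. 1 \<le> a N \<and> a N \<le> b N \<and> b N \<le> N) \<and>
            (\<lambda>N. real N - real (b N)) \<ggreater> (\<lambda>_. 1)
            \<longrightarrow> (\<lambda>N. tv_dist {a N..b N} (marginal {a N..b N} (\<mu> N))
                                       (Ber {a N..b N} (\<alpha> / (1 - q)))) \<longlonglongrightarrow> 0))
     \<and>
     (u * v > 1 \<and> v > max 1 u \<and>
      (\<exists>\<alpha>'>0. \<exists>\<alpha>''>0. \<exists>k\<ge>1.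
         \<alpha> \<in> {\<alpha>'..\<alpha>''} \<and>
         v > Max {boundary_param q \<alpha>', boundary_param q \<alpha>'', 1} \<and>
         boundary_param q \<alpha>' * v * q ^ k = 1 \<and>
         boundary_param q \<alpha>'' * v * q ^ (k - 1) = 1)
      \<longrightarrow> (\<forall>a b :: nat \<Rightarrow> nat.
            (\<forall>N\<ge>1. 1 \<le> a N \<and> a N \<le> b N \<and> b N \<le> N) \<and>
            (\<lambda>N. real (a N)) \<ggreater> (\<lambda>_. 1)
            \<longrightarrow> (\<lambda>N. tv_dist {a N..b N} (marginal {a N..b N} (\<mu> N))
                                       (Ber {a N..b N} (1 - \<beta> / (1 - q)))) \<longlonglongrightarrow> 0))"
proof (intro conjI impI allI; elim conjE exE)
  fix a b :: "nat \<Rightarrow> nat" and \<beta>' \<beta>'' :: real and k :: nat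
  assume uv: "u * v > 1" and ab: "\<forall>N\<ge>1. 1 \<le> a N \<and> a N \<le> b N \<and> b N \<le> N"
    and far: "(\<lambda>N. real N - real (b N)) \<ggreater> (\<lambda>_. 1)"
    and H: "\<beta>' > 0" "k \<ge> 1" "\<beta> \<in> {\<beta>'..\<beta>''}"
      "u > Max {boundary_param q \<beta>', boundary_param q \<beta>'', 1}"
      "u * boundary_param q \<beta>' * q ^ k = 1"
  have shock: "\<alpha> + \<beta> < 1 - q" using uv assms shock_region_iff by simp
  have pre: "\<beta>' \<le> \<beta>" "u > 1" "u > boundary_param q \<beta>'" using H by auto
  show "(\<lambda>N. tv_dist {a N..b N} (marginal {a N..b N} (\<mu> N)) (Ber {a N..b N} (\<alpha> / (1 - q)))) \<longlonglongrightarrow> 0"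
  proof (rule low_density_bound[OF assms(1-3) H(1) pre(1) shock, folded u, OF pre(2,3) H(2,5)])
    fix K r :: real assume r: "0 < r" "r < 1"
    and bound: "\<And>N a b \<mu>. N \<ge> 1 \<Longrightarrow> 1 \<le> a \<Longrightarrow> b \<le> N \<Longrightarrow> asep_stationary N q \<alpha> \<beta> \<mu> \<Longrightarrow>
       tv_dist {a..b} (marginal {a..b} \<mu>) (Ber {a..b} (\<alpha> / (1 - q))) \<le> K * r ^ (N - b)"
    show ?thesis
    proof (rule tendsto_zero_of_geometric_bound[OF r far, where K = K and n = "\<lambda>N. N - b N"])
      fix N :: nat assume N: "N \<ge> 1"
      then have "1 \<le> a N" "b N \<le> N" using ab by auto
      then show "tv_dist {a N..b N} (marginal {a N..b N} (\<mu> N)) (Ber {a N..b N} (\<alpha> / (1 - q))) \<le> K * r ^ (N - b N)"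
        by (rule bound[OF N _ _ \<mu>[OF N]])
      show "real N - real (b N) \<le> real (N - b N) + 1"
        using \<open>1 \<le> a N\<close> \<open>b N \<le> N\<close> by (simp add: of_nat_diff)
    qed (rule tv_dist_nonneg)
  qed
next
  fix a b :: "nat \<Rightarrow> nat" and \<alpha>' \<alpha>'' :: real and k :: nat
  assume uv: "u * v > 1" and ab: "\<forall>N\<ge>1. 1 \<le> a N \<and> a N \<le> b N \<and> b N \<le> N"
    and far: "(\<lambda>N. real (a N)) \<ggreater> (\<lambda>_. 1)"
    and H: "\<alpha>' > 0" "k \<ge> 1" "\<alpha> \<in> {\<alpha>'..\<alpha>''}"
      "v > Max {boundary_param q \<alpha>', boundary_param q \<alpha>'', 1}"
      "boundary_param q \<alpha>' * v * q ^ k = 1"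
  have shock: "\<alpha> + \<beta> < 1 - q" using uv assms shock_region_iff by simp
  have pre: "\<alpha>' \<le> \<alpha>" "v > 1" "v > boundary_param q \<alpha>'" using H by auto
  show "(\<lambda>N. tv_dist {a N..b N} (marginal {a N..b N} (\<mu> N)) (Ber {a N..b N} (1 - \<beta> / (1 - q)))) \<longlonglongrightarrow> 0"
  proof (rule high_density_bound[OF assms(1,2,4) H(1) pre(1) shock, folded v, OF pre(2,3) H(2,5)])
    fix K r :: real assume r: "0 < r" "r < 1"
    and bound: "\<And>N a b \<mu>. N \<ge> 1 \<Longrightarrow> 1 \<le> a \<Longrightarrow> b \<le> N \<Longrightarrow> asep_stationary N q \<alpha> \<beta> \<mu> \<Longrightarrow>
       tv_dist {a..b} (marginal {a..b} \<mu>) (Ber {a..b} (1 - \<beta> / (1 - q))) \<le> K * r ^ (a - 1)"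
    show ?thesis
    proof (rule tendsto_zero_of_geometric_bound[OF r far, where K = K and n = "\<lambda>N. a N - 1"])
      fix N :: nat assume N: "N \<ge> 1"
      then have "1 \<le> a N" "b N \<le> N" using ab by auto
      then show "tv_dist {a N..b N} (marginal {a N..b N} (\<mu> N)) (Ber {a N..b N} (1 - \<beta> / (1 - q))) \<le> K * r ^ (a N - 1)"
        by (rule bound[OF N _ _ \<mu>[OF N]])
      show "real (a N) \<le> real (a N - 1) + 1"
        using \<open>1 \<le> a N\<close> \<open>b N \<le> N\<close> by (simp add: of_nat_diff)
    qed (rule tv_dist_nonneg)
  qed
qed

end
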